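(* Let $n,m,a,b\in\mathbb{N}$ with $b<m$, $n\mid b$ and $n\mid m$. Let $\lambda=(a^b)$ be the rectangular partition with $b$ parts all equal to $a$, so that $n\lambda=((na)^b)$. Then the triple $$\bigl(\mathrm{SSYT}(n\lambda,m),\ C_n,\ s_{n\lambda}(1,q,q^2,\dots,q^{m-1})\bigr)$$ exhibits the cyclic sieving phenomenon for some action of the cyclic group $C_n$ of order $n$ on $\mathrm{SSYT}(n\lambda,m)$.
   Context: For a partition $\lambda$, $\mathrm{SSYT}(\lambda,m)$ is the set of semi-standard Young tableaux of shape $\lambda$ with entries in $\{0,1,\dots,m-1\}$: fillings of the Young diagram of $\lambda$ with rows weakly increasing and columns strictly increasing. The Schur polynomial is $s_\lambda(x_0,\dots,x_{m-1})=\sum_{T\in\mathrm{SSYT}(\lambda,m)}x_0^{\alpha_0(T)}\cdots x_{m-1}^{\alpha_{m-1}(T)}$, where $\alpha_k(T)$ is the number of boxes of $T$ containing $k$. Thus $s_\lambda(1,q,\dots,q^{m-1})=\sum_{T\in \mathrm{SSYT}(\lambda,m)}q^{|T|}$, where $|T|$ is the sum of the entries of $T$. For a partition $\lambda=(\lambda_1,\dots,\lambda_r)$, $n\lambda=(n\lambda_1,\dots,n\lambda_r)$. Let $C_n$ be a cyclic group of order $n$ generated by $\sigma_n$ acting on a finite set $X$, and let $f(q)\in\mathbb{N}[q]$. The triple $(X,C_n,f(q))$ exhibits the cyclic sieving phenomenon if $f(\omega_n^k)=|\{x\in X:\sigma_n^k\cdot x=x\}|$ for all $k\in\mathbb{Z}$,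 where $\omega_n$ is a fixed primitive $n$-th root of unity. *)

theory Defs
  imports Complex_Main
    "HOL-Library.FuncSet"
    "HOL-Computational_Algebra.Polynomial"
    "HOL-Algebra.Generated_Groups"
    "HOL-Algebra.Group_Action"
begin

text \<open>
  A partition is represented by the list of its parts in weakly decreasing order; trailing
  zeros are allowed and contribute no boxes. Rows and columns of the Young diagram are
  indexed from 0.
\<close>

definition young_diagram :: "nat list \<Rightarrow> (nat \<times> nat) set" where
  "young_diagram lam = {(i, j). i < length lam \<and> j < lam ! i}"

definition scale_partition :: "nat \<Rightarrow> nat list \<Rightarrow> nat list" where
  "scale_partition n lam = map (\<lambda>p. n * p) lam"

text \<open>
  A tableau is an extensional function on the boxes (it is \<open>undefined\<close> off the diagram), so
  distinct elements of \<open>SSYT lam m\<close> are distinct fillings.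
\<close>

definition SSYT :: "nat list \<Rightarrow> nat \<Rightarrow> (nat \<times> nat \<Rightarrow> nat) set" where
  "SSYT lam m = {T \<in> young_diagram lam \<rightarrow>\<^sub>E {0..<m}.
     (\<forall>i j j'. (i, j) \<in> young_diagram lam \<longrightarrow> (i, j') \<in> young_diagram lam \<longrightarrow>
        j < j' \<longrightarrow> T (i, j) \<le> T (i, j')) \<and>
     (\<forall>i i' j. (i, j) \<in> young_diagram lam \<longrightarrow> (i', j) \<in> young_diagram lam \<longrightarrow>
        i < i' \<longrightarrow> T (i, j) < T (i', j))}"

definition content :: "nat list \<Rightarrow> (nat \<times> nat \<Rightarrow> nat) \<Rightarrow> nat \<Rightarrow> nat" where
  "content lam T k = card {c \<in> young_diagram lam. T c = k}"

text \<open>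
  The Schur polynomial in \<open>m\<close> variables, given by its value at a point
  \<open>(x 0, \<dots>, x (m - 1))\<close> of an arbitrary commutative semiring; this includes polynomial
  semirings, which is how one-variable specialisations are obtained.
\<close>

definition schur :: "nat list \<Rightarrow> nat \<Rightarrow> (nat \<Rightarrow> 'a :: comm_semiring_1) \<Rightarrow> 'a" where
  "schur lam m x = (\<Sum>T\<in>SSYT lam m. \<Prod>k<m. x k ^ content lam T k)"

definition principal_schur :: "nat list \<Rightarrow> nat \<Rightarrow> nat poly" where
  "principal_schur lam m = schur lam m (\<lambda>k. monom 1 1 ^ k)"

definition primitive_root_of_unity :: "nat \<Rightarrow> complex \<Rightarrow> bool" where
  "primitive_root_of_unity n \<omega> \<longleftrightarrow> 0 < n \<and> \<omega> ^ n = 1 \<and> (\<forall>k. 0 < k \<and> k < n \<longrightarrow> \<omega> ^ k \<noteq> 1)"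

text \<open>\<open>order\<close> is qualified because it is also the name of the multiplicity of a polynomial root.\<close>

definition cyclic_of_order :: "nat \<Rightarrow> ('g, 'z) monoid_scheme \<Rightarrow> 'g \<Rightarrow> bool" where
  "cyclic_of_order n G \<sigma> \<longleftrightarrow>
     group G \<and> Coset.order G = n \<and> \<sigma> \<in> carrier G \<and> generate G {\<sigma>} = carrier G"

text \<open>
  The triple \<open>(X, G, f)\<close>, with \<open>G\<close> cyclic of order \<open>n\<close> generated by \<open>\<sigma>\<close> and acting on \<open>X\<close>
  via \<open>\<phi>\<close>, exhibits the cyclic sieving phenomenon with respect to the primitive \<open>n\<close>-th root
  of unity \<open>\<omega>\<close>.
\<close>

definition cyclic_sieving ::
  "nat \<Rightarrow> complex \<Rightarrow> ('g, 'z) monoid_scheme \<Rightarrow> 'g \<Rightarrow> ('g \<Rightarrow> 'a \<Rightarrow> 'a) \<Rightarrow> 'a set \<Rightarrow> nat poly \<Rightarrow> bool"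
  where
  "cyclic_sieving n \<omega> G \<sigma> \<phi> X f \<longleftrightarrow>
     primitive_root_of_unity n \<omega> \<and> cyclic_of_order n G \<sigma> \<and>
     finite X \<and> group_action G X \<phi> \<and>
     (\<forall>k::int. poly (map_poly of_nat f) (\<omega> powi k) =
        of_nat (card (invariants X \<phi> (\<sigma> [^]\<^bsub>G\<^esub> k))))"

end

theory Submission
  imports Defs
    "Jordan_Normal_Form.Determinant"
    "HOL-Computational_Algebra.Computational_Algebra"
    "HOL-Algebra.Multiplicative_Group"
begin

text \<open>
  Write \<open>b = n * B\<close> and \<open>m = n * M\<close>, and let \<open>K j\<close> be the number of semistandard tableaux on
  a rectangle with \<open>B * j\<close> rows of length \<open>a * j\<close>, with entries below \<open>M * j\<close>.

  The first half of the argument evaluates the polynomial. By the Jacobi-Trudi formula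
  (\<open>jacobi_trudi\<close>) the principal specialisation is the determinant of the complete homogeneous
  symmetric polynomials \<open>h\<^sub>k\<close> with \<open>k = n a - i + j\<close>. At the powers of a primitive \<open>d\<close>-th root of
  unity, where \<open>d\<close> divides the number of variables, the generating function of the \<open>h\<^sub>k\<close> is a
  power of \<open>1 / (1 - X ^ d)\<close>. So \<open>h\<^sub>k\<close> vanishes unless \<open>d\<close> divides \<open>k\<close>, and \<open>h\<^sub>d\<^sub>k\<close> is the
  complete symmetric polynomial of degree \<open>k\<close> in \<open>d\<close> times fewer variables, evaluated with every
  variable set to 1. Sorting rows and
  columns by their residue mod \<open>d\<close> turns the matrix into \<open>d\<close> equal diagonal blocks, each of which is
  again a Jacobi-Trudi matrix (\<open>schur_rectangle_at_roots\<close>). Hence the value at \<open>\<omega> ^ k\<close> is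
  \<open>F (gcd k n)\<close> with \<open>F j = K j ^ (n div j)\<close>.

  The second half produces an action whose fixed points are counted by \<open>F\<close>. If \<open>T D\<close> is
  the number of elements in orbits of size \<open>D\<close>, then \<open>\<sigma> ^ k\<close> fixes the elements whose orbit size
  divides \<open>gcd k n\<close>; so \<open>T\<close> is determined by requiring that \<open>F j\<close> be the sum of \<open>T\<close> over the
  divisors of \<open>j\<close>, and an action exists as soon as every \<open>T D\<close> is a nonnegative multiple
  of \<open>D\<close> (\<open>cyclic_action_with_orbit_counts\<close>). Divisibility follows from the integrality of the
  coefficients of the polynomial mod \<open>q ^ n - 1\<close>, which are recovered from its values by a
  finite Fourier transform (\<open>dvd_orbit_size_total\<close>). Nonnegativity follows from growth: a
  tableau of rectangular shape is a plane partition in a box, and stacking \<open>k (k + 1) / 2\<close> small boxes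
  inside a box enlarged by the factor \<open>k\<close> (\<open>box_partitions_stack\<close>) gives
  \<open>F E ^ (k + 1) \<le> F (E * k) ^ 2\<close>. Together with \<open>K 1 \<ge> 2\<close> this makes \<open>F D\<close> at least the sum of \<open>F\<close>
  over the proper divisors of \<open>D\<close> (\<open>growth_dominates_divisors\<close>). The only exception is the empty shape, where
  \<open>F\<close> is constantly 1.
\<close>

section \<open>Branching of Schur polynomials\<close>

text \<open>
  Partitions with at most \<open>b\<close> rows are handled as functions on row indices, so that families of
  them are function spaces and sums over them can be expanded as products.
\<close>

abbreviation shape :: "nat \<Rightarrow> (nat \<Rightarrow> nat) \<Rightarrow> nat list" where
  "shape b lam \<equiv> map lam [0..<b]"

lemma young_diagram_shape: "(i, j) \<in> young_diagram (shape b lam) \<longleftrightarrow> i < b \<and> j < lam i"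
  by (auto simp: young_diagram_def)

lemma young_diagram_shape_Sigma: "young_diagram (shape b lam) = Sigma {..<b} (\<lambda>i. {..<lam i})"
  by (auto simp: young_diagram_def)

lemma finite_young_diagram [simp]: "finite (young_diagram lam)"
proof -
  have "young_diagram lam = Sigma {..<length lam} (\<lambda>i. {..<lam ! i})"
    by (auto simp: young_diagram_def)
  then show ?thesis by simp
qed

lemma finite_SSYT [simp]: "finite (SSYT lam m)"
  unfolding SSYT_def by (rule finite_subset[of _ "young_diagram lam \<rightarrow>\<^sub>E {0..<m}"]) (auto intro: finite_PiE)

lemma SSYT_shape_iff:
  "T \<in> SSYT (shape b lam) m \<longleftrightarrow> T \<in> extensional (young_diagram (shape b lam)) \<and>
     (\<forall>i<b. \<forall>j<lam i. T (i, j) < m) \<and>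
     (\<forall>i<b. \<forall>j'<lam i. \<forall>j<j'. T (i, j) \<le> T (i, j')) \<and>
     (\<forall>i'<b. \<forall>i<i'. \<forall>j<lam i'. j < lam i \<longrightarrow> T (i, j) < T (i', j))"
  unfolding SSYT_def PiE_iff young_diagram_shape split_paired_all Ball_def mem_Collect_eq
  by (auto simp: young_diagram_shape)

text \<open>
  Each box contributes the variable of its entry; this box-by-box form is the one that splits when
  boxes are removed.
\<close>

lemma schur_as_weight_sum:
  "schur lam m x = (\<Sum>T\<in>SSYT lam m. \<Prod>c\<in>young_diagram lam. x (T c))"
  unfolding schur_def
proof (rule sum.cong[OF refl])
  fix T assume T: "T \<in> SSYT lam m"
  have "(\<Prod>c\<in>young_diagram lam. x (T c))
      = (\<Prod>k<m. \<Prod>c\<in>{c \<in> young_diagram lam. T c = k}. x (T c))"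
    using T by (intro prod.group[symmetric]) (auto simp: SSYT_def PiE_iff)
  also have "\<dots> = (\<Prod>k<m. x k ^ content lam T k)"
    by (intro prod.cong) (auto simp: content_def)
  finally show "(\<Prod>k<m. x k ^ content lam T k) = (\<Prod>c\<in>young_diagram lam. x (T c))" ..
qed

text \<open>
  The row below the last one counts as empty, which gives the interlacing condition on the last row
  its lower bound 0.
\<close>

definition next_part :: "nat \<Rightarrow> (nat \<Rightarrow> nat) \<Rightarrow> nat \<Rightarrow> nat" where
  "next_part b lam i = (if Suc i < b then lam (Suc i) else 0)"

definition interlacing :: "nat \<Rightarrow> (nat \<Rightarrow> nat) \<Rightarrow> (nat \<Rightarrow> nat) set" where
  "interlacing b lam = (\<Pi>\<^sub>E i\<in>{..<b}. {next_part b lam i..lam i})"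

lemma interlacingD:
  assumes "\<mu> \<in> interlacing b lam" "i < b"
  shows "\<mu> i \<le> lam i" "next_part b lam i \<le> \<mu> i"
  using assms by (auto simp: interlacing_def PiE_iff)

lemma antitone_chain:
  fixes lam :: "nat \<Rightarrow> nat"
  assumes "\<And>i. Suc i < b \<Longrightarrow> lam (Suc i) \<le> lam i" "i \<le> i'" "i' < b"
  shows "lam i' \<le> lam i"
  using assms(2,3)
proof (induction rule: dec_induct)
  case (step k)
  then show ?case using assms(1)[of k] by simp
qed simp

lemma interlacing_antitone:
  assumes "\<mu> \<in> interlacing b lam" "Suc i < b"
  shows "\<mu> (Suc i) \<le> \<mu> i"
  using interlacingD[OF assms(1), of i] interlacingD[OF assms(1), of "Suc i"] assms(2)
  by (simp add: next_part_def)

text \<open>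
  The row lengths of the part of \<open>T\<close> with entries below \<open>m\<close>; as rows increase weakly, these entries
  form an initial segment of each row.
\<close>

definition small_part :: "nat \<Rightarrow> (nat \<Rightarrow> nat) \<Rightarrow> nat \<Rightarrow> (nat \<times> nat \<Rightarrow> nat) \<Rightarrow> nat \<Rightarrow> nat" where
  "small_part b lam m T = (\<lambda>i\<in>{..<b}. LEAST j. lam i \<le> j \<or> m \<le> T (i, j))"

lemma small_part_le: "i < b \<Longrightarrow> small_part b lam m T i \<le> lam i"
  by (auto simp: small_part_def intro: Least_le)

lemma less_small_part_iff:
  assumes T: "T \<in> SSYT (shape b lam) (Suc m)" and ij: "i < b" "j < lam i"
  shows "j < small_part b lam m T i \<longleftrightarrow> T (i, j) < m"
proof
  assume "j < small_part b lam m T i"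
  then show "T (i, j) < m"
    using ij not_less_Least[of j "\<lambda>j. lam i \<le> j \<or> m \<le> T (i, j)"] by (auto simp: small_part_def)
next
  assume less: "T (i, j) < m"
  show "j < small_part b lam m T i"
  proof (rule ccontr)
    let ?s = "small_part b lam m T i"
    assume "\<not> j < ?s"
    then have sj: "?s \<le> j" by simp
    have "lam i \<le> ?s \<or> m \<le> T (i, ?s)"
      using ij LeastI[of "\<lambda>j. lam i \<le> j \<or> m \<le> T (i, j)" "lam i"] by (simp add: small_part_def)
    then have "m \<le> T (i, ?s)" using sj ij by auto
    moreover have "T (i, ?s) \<le> T (i, j)"
      using T ij sj unfolding SSYT_shape_iff by (cases "?s = j") auto
    ultimately show False using less by simp
  qed
qed

text \<open>
  An entry in row \<open>i\<close> that has a box below it is smaller than that box, hence below the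
  maximal entry \<open>m\<close>: this is why row \<open>i\<close> keeps at least the length of row \<open>i + 1\<close>.
\<close>

lemma small_part_interlacing:
  assumes anti: "\<And>i. Suc i < b \<Longrightarrow> lam (Suc i) \<le> lam i"
    and T: "T \<in> SSYT (shape b lam) (Suc m)"
  shows "small_part b lam m T \<in> interlacing b lam"
proof -
  have "next_part b lam i \<le> small_part b lam m T i" if i: "i < b" for i
  proof (rule ccontr)
    let ?s = "small_part b lam m T i"
    assume "\<not> next_part b lam i \<le> ?s"
    then have S: "Suc i < b" and s: "?s < lam (Suc i)"
      by (auto simp: next_part_def split: if_splits)
    then have "?s < lam i" using anti[of i] by simp
    moreover have "T (i, ?s) < T (Suc i, ?s)" "T (Suc i, ?s) < Suc m"
      using T S s \<open>?s < lam i\<close> unfolding SSYT_shape_iff by auto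
    ultimately show False using less_small_part_iff[OF T i, of ?s] by auto
  qed
  then show ?thesis
    by (simp add: interlacing_def PiE_iff small_part_le) (simp add: small_part_def)
qed

text \<open>
  Deleting the boxes with the largest entry \<open>m\<close> is a bijection onto pairs of an interlacing
  shape and a tableau on it: at most one \<open>m\<close> fits into each column, and interlacing says
  exactly that no two deleted boxes lie in the same column.
\<close>

lemma schur_branching:
  assumes anti: "\<And>i. Suc i < b \<Longrightarrow> lam (Suc i) \<le> lam i"
  shows "schur (shape b lam) (Suc m) x =
    (\<Sum>\<mu>\<in>interlacing b lam. (\<Prod>i<b. x m ^ (lam i - \<mu> i)) * schur (shape b \<mu>) m x)"
proof -
  let ?D = "\<lambda>\<mu>. young_diagram (shape b \<mu>)"
  let ?S = "\<lambda>\<mu>. SSYT (shape b \<mu>) m"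
  let ?s = "small_part b lam m"
  define cut where "cut T = (?s T, restrict T (?D (?s T)))" for T
  define fill where "fill p = (\<lambda>c\<in>?D lam. if c \<in> ?D (fst p) then snd p c else m)"
    for p :: "(nat \<Rightarrow> nat) \<times> (nat \<times> nat \<Rightarrow> nat)"
  have sub: "?D \<mu> \<subseteq> ?D lam" if "\<mu> \<in> interlacing b lam" for \<mu>
    using interlacingD(1)[OF that] by (fastforce simp: young_diagram_def)
  have fin: "finite (interlacing b lam)"
    by (auto simp: interlacing_def intro: finite_PiE)
  have cut: "cut T \<in> Sigma (interlacing b lam) ?S" and fill_cut: "fill (cut T) = T"
    if T: "T \<in> SSYT (shape b lam) (Suc m)" for T
  proof -
    have le: "j < lam i" if "i < b" "j < ?s T i" for i j
      using that small_part_le[of i b lam m T] by simp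
    have "restrict T (?D (?s T)) \<in> ?S (?s T)"
      using T le less_small_part_iff[OF T] unfolding SSYT_shape_iff
      by (auto simp: young_diagram_shape)
    then show "cut T \<in> Sigma (interlacing b lam) ?S"
      using small_part_interlacing[OF anti T] by (simp add: cut_def)
    show "fill (cut T) = T"
    proof
      fix c :: "nat \<times> nat"
      obtain i j where c: "c = (i, j)" by force
      have "T (i, j) = m" if "i < b" "j < lam i" "\<not> j < ?s T i"
      proof -
        have "T (i, j) < Suc m" using T that unfolding SSYT_shape_iff by blast
        then show ?thesis using less_small_part_iff[OF T that(1,2)] that by auto
      qed
      moreover have "T (i, j) = undefined" if "(i, j) \<notin> ?D lam"
        using T that unfolding SSYT_shape_iff extensional_def by blast
      ultimately show "fill (cut T) c = T c"
        by (auto simp: c fill_def cut_def restrict_def young_diagram_shape)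
    qed
  qed
  have fill: "fill p \<in> SSYT (shape b lam) (Suc m)" and cut_fill: "cut (fill p) = p"
    and weight: "(\<Prod>c\<in>?D lam. x (fill p c))
       = (\<Prod>i<b. x m ^ (lam i - fst p i)) * (\<Prod>c\<in>?D (fst p). x (snd p c))"
    if p: "p \<in> Sigma (interlacing b lam) ?S" for p
  proof -
    obtain \<mu> S where pe: "p = (\<mu>, S)" by force
    then have mu: "\<mu> \<in> interlacing b lam" and S: "S \<in> ?S \<mu>" using p by auto
    note le = interlacingD[OF mu]
    have f: "fill p (i, j) = (if j < \<mu> i then S (i, j) else m)" if "i < b" "j < lam i" for i j
      using that by (simp add: fill_def pe young_diagram_shape)
    have small: "j < \<mu> i" if "i < i'" "i' < b" "j < lam i'" for i i' j
    proof -
      have "lam i' \<le> lam (Suc i)" using antitone_chain[of b lam "Suc i" i'] anti that by simp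
      also have "\<dots> \<le> \<mu> i" using le(2)[of i] that by (simp add: next_part_def)
      finally show ?thesis using that by simp
    qed
    have Sm: "S (i, j) < m" if "i < b" "j < \<mu> i" for i j
      using S that unfolding SSYT_shape_iff by blast
    have row: "fill p (i, j) \<le> fill p (i, j')" if "i < b" "j' < lam i" "j < j'" for i j j'
      using that S Sm[of i j, THEN less_imp_le] f[of i j] f[of i j'] unfolding SSYT_shape_iff by simp
    have col: "fill p (i, j) < fill p (i', j)" if "i < i'" "i' < b" "j < lam i'" "j < lam i" for i i' j
      using that S Sm[of i j] f[of i j] f[of i' j] small[OF that(1-3)] unfolding SSYT_shape_iff by auto
    show *: "fill p \<in> SSYT (shape b lam) (Suc m)"
      unfolding SSYT_shape_iff
    proof (intro conjI allI impI)
      show "fill p \<in> extensional (?D lam)" by (simp add: fill_def)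
    next
      fix i j assume "i < b" "j < lam i"
      then show "fill p (i, j) < Suc m" using Sm[of i j] f[of i j] by auto
    qed (use row col in auto)
    have s: "?s (fill p) i = \<mu> i" if i: "i < b" for i
    proof -
      have "j < ?s (fill p) i \<longleftrightarrow> j < \<mu> i" for j
      proof (cases "j < lam i")
        case True
        then show ?thesis using less_small_part_iff[OF * i True] f[OF i True] Sm[of i j] i by auto
      next
        case False
        then show ?thesis using small_part_le[OF i, of lam m "fill p"] le(1)[OF i] by simp
      qed
      then show ?thesis by (metis nat_neq_iff)
    qed
    have s': "?s (fill p) = \<mu>"
    proof
      fix i show "?s (fill p) i = \<mu> i"
        using s[of i] mu by (cases "i < b") (auto simp: small_part_def interlacing_def PiE_iff extensional_def)
    qed
    have "restrict (fill p) (?D \<mu>) = S"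
    proof
      fix c
      have "S \<in> extensional (?D \<mu>)" using S unfolding SSYT_shape_iff by blast
      then have "S c = undefined" if "c \<notin> ?D \<mu>" using that by (rule extensional_arb)
      moreover have "c \<in> ?D lam" if "c \<in> ?D \<mu>" using sub[OF mu] that by blast
      ultimately show "restrict (fill p) (?D \<mu>) c = S c"
        by (cases "c \<in> ?D \<mu>") (simp_all add: fill_def pe)
    qed
    then show "cut (fill p) = p" unfolding cut_def s' by (simp only: pe)
    have "(\<Prod>c\<in>?D lam. x (fill p c)) = (\<Prod>c\<in>?D lam - ?D \<mu>. x (fill p c)) * (\<Prod>c\<in>?D \<mu>. x (fill p c))"
      by (rule prod.subset_diff) (use sub[OF mu] in auto)
    also have "(\<Prod>c\<in>?D \<mu>. x (fill p c)) = (\<Prod>c\<in>?D \<mu>. x (S c))"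
      using sub[OF mu] by (intro prod.cong) (auto simp: fill_def pe)
    also have "(\<Prod>c\<in>?D lam - ?D \<mu>. x (fill p c)) = (\<Prod>c\<in>?D lam - ?D \<mu>. x m)"
      by (intro prod.cong) (auto simp: fill_def pe)
    also have "?D lam - ?D \<mu> = Sigma {..<b} (\<lambda>i. {\<mu> i..<lam i})"
      by (auto simp: young_diagram_shape_Sigma)
    also have "(\<Prod>c\<in>Sigma {..<b} (\<lambda>i. {\<mu> i..<lam i}). x m) = (\<Prod>i<b. x m ^ (lam i - \<mu> i))"
      by (simp add: power_sum)
    finally show "(\<Prod>c\<in>?D lam. x (fill p c))
       = (\<Prod>i<b. x m ^ (lam i - fst p i)) * (\<Prod>c\<in>?D (fst p). x (snd p c))" by (simp add: pe)
  qed
  have "schur (shape b lam) (Suc m) x = (\<Sum>p\<in>Sigma (interlacing b lam) ?S.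
     (\<Prod>i<b. x m ^ (lam i - fst p i)) * (\<Prod>c\<in>?D (fst p). x (snd p c)))"
    unfolding schur_as_weight_sum
  proof (rule sum.reindex_bij_witness[where i = fill and j = cut])
    fix T assume T: "T \<in> SSYT (shape b lam) (Suc m)"
    show "(\<Prod>i<b. x m ^ (lam i - fst (cut T) i)) * (\<Prod>c\<in>?D (fst (cut T)). x (snd (cut T) c))
      = (\<Prod>c\<in>?D lam. x (T c))"
      using weight[OF cut[OF T]] by (simp only: fill_cut[OF T])
  qed (fact fill_cut cut cut_fill fill)+
  also have "\<dots> = (\<Sum>\<mu>\<in>interlacing b lam. \<Sum>S\<in>?S \<mu>.
     (\<Prod>i<b. x m ^ (lam i - \<mu> i)) * (\<Prod>c\<in>?D \<mu>. x (S c)))"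
    by (subst sum.Sigma) (simp_all add: fin case_prod_beta)
  finally show ?thesis by (simp only: schur_as_weight_sum sum_distrib_left)
qed

section \<open>The Jacobi-Trudi formula\<close>

text \<open>
  The complete homogeneous symmetric polynomial of degree \<open>k\<close> in \<open>x 0, \<dots>, x (m - 1)\<close>, read off its
  generating function. Integer degrees are used because the indices of the Jacobi-Trudi matrix
  become negative.
\<close>

definition hsym :: "(nat \<Rightarrow> 'a :: field) \<Rightarrow> nat \<Rightarrow> int \<Rightarrow> 'a" where
  "hsym x m k = (if k < 0 then 0
     else fps_nth (\<Prod>i<m. inverse (1 - fps_const (x i) * fps_X)) (nat k))"

lemma hsym_0: "hsym x 0 k = (if k = 0 then 1 else 0)"
  by (auto simp: hsym_def)

lemma hsym_neg: "k < 0 \<Longrightarrow> hsym x m k = 0"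
  by (simp add: hsym_def)

lemma hsym_Suc: "hsym x (Suc m) k = hsym x m k + x m * hsym x (Suc m) (k - 1)"
proof (cases "k < 0")
  case False
  define P where "P = (\<Prod>i<m. inverse (1 - fps_const (x i) * fps_X))"
  let ?e = "1 - fps_const (x m) * fps_X"
  define Q where "Q = P * inverse ?e"
  have "inverse ?e * ?e = 1" by (rule inverse_mult_eq_1) simp
  then have "Q * ?e = P" by (simp add: Q_def mult.assoc)
  then have Q: "Q = P + fps_const (x m) * (fps_X * Q)" by (simp add: algebra_simps)
  have "fps_nth Q (nat k) = fps_nth P (nat k) + x m * fps_nth (fps_X * Q) (nat k)"
    by (subst Q) simp
  then show ?thesis
    using False by (auto simp: hsym_def P_def[symmetric] Q_def[symmetric] nat_diff_distrib)
qed (simp add: hsym_neg)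

text \<open>
  Iterating the recursion expands \<open>m + 1\<close> variables in terms of \<open>m\<close> variables and leaves a remainder
  that is the same function at a smaller degree. In the Jacobi-Trudi matrix this remainder is a
  multiple of an entry of the next row.
\<close>

lemma hsym_Suc_unroll:
  "hsym x (Suc m) k = (\<Sum>t<s. x m ^ t * hsym x m (k - int t)) + x m ^ s * hsym x (Suc m) (k - int s)"
proof (induction s)
  case (Suc s)
  then show ?case
    using hsym_Suc[of x m "k - int s"] by (simp add: algebra_simps)
qed simp

definition jt_mat :: "nat \<Rightarrow> (nat \<Rightarrow> nat) \<Rightarrow> nat \<Rightarrow> (nat \<Rightarrow> 'a :: field) \<Rightarrow> 'a mat" where
  "jt_mat b lam m x = mat b b (\<lambda>(i, j). hsym x m (int (lam i) - int i + int j))"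

lemma jt_mat_carrier [simp]: "jt_mat b lam m x \<in> carrier_mat b b"
  by (simp add: jt_mat_def)

text \<open>
  Multilinearity of the determinant in all rows at once; the choice of one summand in every row
  is a function \<open>\<mu>\<close>, which is where the sum over interlacing shapes will come from.
\<close>

lemma det_sum_rows:
  fixes c :: "nat \<Rightarrow> 'b \<Rightarrow> 'a :: comm_ring_1" and R :: "nat \<Rightarrow> 'b \<Rightarrow> nat \<Rightarrow> 'a"
  assumes "\<And>i. i < b \<Longrightarrow> finite (I i)"
  shows "det (mat b b (\<lambda>(i, j). \<Sum>p\<in>I i. c i p * R i p j)) =
    (\<Sum>\<mu>\<in>(\<Pi>\<^sub>E i\<in>{..<b}. I i). (\<Prod>i<b. c i (\<mu> i)) * det (mat b b (\<lambda>(i, j). R i (\<mu> i) j)))"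
proof -
  let ?P = "{\<pi>. \<pi> permutes {0..<b}}"
  have lt: "\<pi> i < b" if "\<pi> \<in> ?P" "i < b" for \<pi> i
    using that permutes_in_image[of \<pi> "{0..<b}" i] by simp
  have "det (mat b b (\<lambda>(i, j). \<Sum>p\<in>I i. c i p * R i p j)) =
      (\<Sum>\<pi>\<in>?P. signof \<pi> * (\<Prod>i\<in>{..<b}. \<Sum>p\<in>I i. c i p * R i p (\<pi> i)))"
    by (subst det_def'[of _ b]) (auto intro!: sum.cong prod.cong simp: lt lessThan_atLeast0)
  also have "\<dots> = (\<Sum>\<pi>\<in>?P. signof \<pi> *
      (\<Sum>\<mu>\<in>(\<Pi>\<^sub>E i\<in>{..<b}. I i). \<Prod>i<b. c i (\<mu> i) * R i (\<mu> i) (\<pi> i)))"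
    by (subst prod_sum_PiE) (use assms in auto)
  also have "\<dots> = (\<Sum>\<mu>\<in>(\<Pi>\<^sub>E i\<in>{..<b}. I i). \<Sum>\<pi>\<in>?P. signof \<pi> *
      (\<Prod>i<b. c i (\<mu> i) * R i (\<mu> i) (\<pi> i)))"
    unfolding sum_distrib_left by (rule sum.swap)
  also have "\<dots> = (\<Sum>\<mu>\<in>(\<Pi>\<^sub>E i\<in>{..<b}. I i). (\<Prod>i<b. c i (\<mu> i)) *
      det (mat b b (\<lambda>(i, j). R i (\<mu> i) j)))"
    by (rule sum.cong[OF refl], subst det_def'[of _ b])
      (auto intro!: sum.cong prod.cong simp: lt lessThan_atLeast0 sum_distrib_left prod.distrib mult_ac)
  finally show ?thesis .
qed

text \<open>
  The row operation is multiplication by a unitriangular matrix.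
\<close>

lemma det_subtract_next_rows:
  fixes A :: "'a :: comm_ring_1 mat"
  assumes A: "A \<in> carrier_mat b b"
  shows "det (mat b b (\<lambda>(i, j). A $$ (i, j) - (if Suc i < b then c i * A $$ (Suc i, j) else 0))) = det A"
proof -
  define U where "U = mat b b (\<lambda>(i, k). if k = i then 1 else if k = Suc i then - c i else 0)"
  have U: "U \<in> carrier_mat b b" by (simp add: U_def)
  have "det U = 1"
  proof -
    have "upper_triangular U" by (auto simp: U_def)
    then have "det U = prod_list (diag_mat U)" using U by (rule det_upper_triangular)
    also have "diag_mat U = map (\<lambda>i. 1) [0..<b]" by (auto simp: diag_mat_def U_def)
    finally show ?thesis by (simp add: map_replicate_const)
  qed
  moreover have "U * A = mat b b (\<lambda>(i, j). A $$ (i, j) - (if Suc i < b then c i * A $$ (Suc i, j) else 0))"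
    (is "_ = ?B")
  proof (rule eq_matI)
    fix i j assume "i < dim_row ?B" "j < dim_col ?B"
    then have ij: "i < b" "j < b" by auto
    have "(U * A) $$ (i, j) = (\<Sum>k<b. U $$ (i, k) * A $$ (k, j))"
      using A U ij by (simp add: scalar_prod_def lessThan_atLeast0)
    also have "\<dots> = (\<Sum>k<b. (if k = i then A $$ (k, j) else 0) + (if k = Suc i then - c i * A $$ (k, j) else 0))"
      using ij by (intro sum.cong) (auto simp: U_def)
    also have "\<dots> = ?B $$ (i, j)"
      using ij by (simp add: sum.distrib)
    finally show "(U * A) $$ (i, j) = ?B $$ (i, j)" .
  qed (use A U in auto)
  ultimately show ?thesis using det_mult[OF U A] by simp
qed

text \<open>
  Both sides satisfy the same branching recursion in the number of variables. For the
  determinant, subtracting from row \<open>i\<close> the right multiple of row \<open>i + 1\<close> leaves exactly a weighted sum of the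
  \<open>m\<close>-variable rows with \<open>next_part b lam i \<le> p \<le> lam i\<close>, and multilinearity expands it over
  the interlacing shapes.
\<close>

lemma jacobi_trudi:
  fixes x :: "nat \<Rightarrow> 'a :: field"
  assumes "\<And>i. Suc i < b \<Longrightarrow> lam (Suc i) \<le> lam i"
  shows "schur (shape b lam) m x = det (jt_mat b lam m x)"
  using assms
proof (induction m arbitrary: lam)
  case 0
  show ?case
  proof (cases "\<forall>i<b. lam i = 0")
    case True
    then have D: "young_diagram (shape b lam) = {}" by (auto simp: young_diagram_def)
    then have "SSYT (shape b lam) 0 = {\<lambda>_. undefined}" by (auto simp: SSYT_def)
    moreover have "jt_mat b lam 0 x = 1\<^sub>m b"
      using True by (intro eq_matI) (auto simp: jt_mat_def hsym_0)
    ultimately show ?thesis by (simp add: schur_as_weight_sum D)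
  next
    case False
    then obtain i where i: "i < b" "lam i > 0" by auto
    then have l0: "lam 0 > 0" "b > 0" using antitone_chain[of b lam 0 i] 0 by auto
    have "SSYT (shape b lam) 0 = {}" using l0 by (auto simp: SSYT_shape_iff)
    moreover have "det (jt_mat b lam 0 x) = 0"
    proof (subst det_def'[of _ b])
      have "(\<Prod>i = 0..<b. jt_mat b lam 0 x $$ (i, \<pi> i)) = 0" if "\<pi> permutes {0..<b}" for \<pi>
        using l0 permutes_in_image[OF that, of 0]
        by (intro prod_zero bexI[of _ 0]) (auto simp: jt_mat_def hsym_0)
      then show "(\<Sum>\<pi> | \<pi> permutes {0..<b}. signof \<pi> * (\<Prod>i = 0..<b. jt_mat b lam 0 x $$ (i, \<pi> i))) = 0"
        by (intro sum.neutral) auto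
    qed simp
    ultimately show ?thesis by (simp add: schur_as_weight_sum)
  qed
next
  case (Suc m)
  let ?h = "hsym x (Suc m)" and ?l = "\<lambda>i. int (lam i) - int i"
  let ?next = "next_part b lam"
  have next_le: "?next i \<le> lam i" if "i < b" for i
    using Suc.prems[of i] by (simp add: next_part_def)
  have entry: "jt_mat b lam (Suc m) x $$ (i, j) -
      (if Suc i < b then x m ^ (Suc (lam i - ?next i)) * jt_mat b lam (Suc m) x $$ (Suc i, j) else 0) =
      (\<Sum>p\<in>{?next i..lam i}. x m ^ (lam i - p) * hsym x m (int p - int i + int j))"
    if ij: "i < b" "j < b" for i j
  proof -
    \<comment> \<open>The length of the expansion is chosen so that the remainder is the entry of row \<open>i + 1\<close>; in
      the last row it has negative degree and vanishes.\<close>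
    let ?s = "Suc (lam i - ?next i)"
    have "?h (?l i + int j) = (\<Sum>t<?s. x m ^ t * hsym x m (?l i + int j - int t)) +
        x m ^ ?s * ?h (?l i + int j - int ?s)"
      by (rule hsym_Suc_unroll)
    also have "(\<Sum>t<?s. x m ^ t * hsym x m (?l i + int j - int t)) =
        (\<Sum>p\<in>{?next i..lam i}. x m ^ (lam i - p) * hsym x m (int p - int i + int j))"
      using next_le[OF ij(1)]
      by (intro sum.reindex_bij_witness[where i = "\<lambda>p. lam i - p" and j = "\<lambda>t. lam i - t"])
        (auto simp: of_nat_diff algebra_simps)
    also have "?h (?l i + int j - int ?s) = (if Suc i < b then ?h (?l (Suc i) + int j) else 0)"
      using next_le[OF ij(1)] ij
      by (auto simp: next_part_def of_nat_diff algebra_simps intro!: hsym_neg)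
    finally show ?thesis using ij by (simp add: jt_mat_def)
  qed
  have "det (jt_mat b lam (Suc m) x) = det (mat b b (\<lambda>(i, j). jt_mat b lam (Suc m) x $$ (i, j) -
      (if Suc i < b then x m ^ (Suc (lam i - ?next i)) * jt_mat b lam (Suc m) x $$ (Suc i, j) else 0)))"
    by (rule det_subtract_next_rows[symmetric]) simp
  also have "\<dots> = det (mat b b (\<lambda>(i, j). \<Sum>p\<in>{?next i..lam i}. x m ^ (lam i - p) * hsym x m (int p - int i + int j)))"
    by (rule arg_cong[where f = det], rule eq_matI) (simp_all add: entry del: power_Suc)
  also have "\<dots> = (\<Sum>\<mu>\<in>interlacing b lam. (\<Prod>i<b. x m ^ (lam i - \<mu> i)) * det (jt_mat b \<mu> m x))"
    by (subst det_sum_rows) (simp_all add: interlacing_def jt_mat_def)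
  also have "\<dots> = schur (shape b lam) (Suc m) x"
  proof (subst schur_branching)
    show "(\<Sum>\<mu>\<in>interlacing b lam. (\<Prod>i<b. x m ^ (lam i - \<mu> i)) * det (jt_mat b \<mu> m x)) =
      (\<Sum>\<mu>\<in>interlacing b lam. (\<Prod>i<b. x m ^ (lam i - \<mu> i)) * schur (shape b \<mu>) m x)"
      by (intro sum.cong refl) (simp add: Suc.IH interlacing_antitone)
  qed (fact Suc.prems)
  finally show ?case ..
qed

section \<open>Rectangular shapes at roots of unity\<close>

lemma root_power_eq_1_iff:
  assumes "primitive_root_of_unity n \<omega>"
  shows "\<omega> ^ k = 1 \<longleftrightarrow> n dvd k"
proof -
  have n: "n > 0" "\<omega> ^ n = 1" and prim: "\<And>k. 0 < k \<Longrightarrow> k < n \<Longrightarrow> \<omega> ^ k \<noteq> 1"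
    using assms by (auto simp: primitive_root_of_unity_def)
  have "\<omega> ^ k = \<omega> ^ (n * (k div n) + k mod n)" by simp
  also have "\<dots> = \<omega> ^ (k mod n)" by (simp only: power_add power_mult n(2)) simp
  finally have "\<omega> ^ k = \<omega> ^ (k mod n)" .
  moreover have "\<omega> ^ (k mod n) = 1 \<longleftrightarrow> k mod n = 0"
    using prim[of "k mod n"] n(1) by auto
  ultimately show ?thesis by (simp add: dvd_eq_mod_eq_0)
qed

lemma primitive_root_power:
  assumes \<omega>: "primitive_root_of_unity n \<omega>"
  shows "primitive_root_of_unity (n div gcd k n) (\<omega> ^ k)"
proof -
  have n: "n > 0" using \<omega> by (simp add: primitive_root_of_unity_def)
  have "(\<omega> ^ k) ^ t = 1 \<longleftrightarrow> n div gcd k n dvd t" for t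
  proof -
    let ?g = "gcd k n"
    have g: "?g > 0" using n by simp
    have "(\<omega> ^ k) ^ t = 1 \<longleftrightarrow> n dvd k * t"
      using root_power_eq_1_iff[OF \<omega>, of "k * t"] by (simp add: power_mult)
    also have "\<dots> \<longleftrightarrow> ?g * (n div ?g) dvd ?g * (k div ?g * t)"
      by (simp flip: mult.assoc)
    also have "\<dots> \<longleftrightarrow> n div ?g dvd k div ?g * t" using g by (simp only: nat_mult_dvd_cancel1)
    also have "\<dots> \<longleftrightarrow> n div ?g dvd t"
      using div_gcd_coprime[of k n] n by (intro coprime_dvd_mult_right_iff) (simp add: coprime_commute)
    finally show ?thesis .
  qed
  moreover have "n div gcd k n > 0" using n by (simp add: div_greater_zero_iff gcd_le2_nat)
  ultimately show ?thesis
    by (auto simp: primitive_root_of_unity_def dest: dvd_imp_le)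
qed

lemma inj_on_root_powers:
  assumes \<omega>: "primitive_root_of_unity n \<omega>"
  shows "inj_on (\<lambda>i. \<omega> ^ i) {..<n}"
proof (rule linorder_inj_onI)
  fix i j assume ij: "i < j" "i \<in> {..<n}" "j \<in> {..<n}"
  have "\<omega> \<noteq> 0" using \<omega> by (auto simp: primitive_root_of_unity_def power_0_left)
  moreover have "\<omega> ^ j = \<omega> ^ i * \<omega> ^ (j - i)" using ij by (simp flip: power_add)
  moreover have "\<omega> ^ (j - i) \<noteq> 1" using ij \<omega> by (auto simp: primitive_root_of_unity_def)
  ultimately show "\<omega> ^ i \<noteq> \<omega> ^ j" by simp
qed auto

text \<open>
  Both sides are polynomials of degree at most \<open>d\<close> which agree at the \<open>d\<close> roots of unity and at 0.
\<close>

lemma prod_one_minus_roots: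
  assumes \<omega>: "primitive_root_of_unity d \<omega>"
  shows "(\<Prod>i<d. 1 - fps_const (\<omega> ^ i) * fps_X) = 1 - fps_X ^ d"
proof -
  have d: "d > 0" "\<omega> ^ d = 1" using \<omega> by (auto simp: primitive_root_of_unity_def)
  let ?p = "\<Prod>i<d. [:1, - (\<omega> ^ i):]" and ?q = "1 - Polynomial.monom 1 d :: complex poly"
  let ?A = "insert 0 ((\<lambda>i. \<omega> ^ i) ` {..<d})"
  have "card ?A = Suc d"
    using inj_on_root_powers[OF \<omega>] d
    by (subst card_insert_disjoint) (auto simp: card_image power_0_left)
  moreover have "degree ?p \<le> d"
  proof -
    have "degree ?p \<le> (\<Sum>i<d. degree [:1, - (\<omega> ^ i):])"
      using degree_prod_sum_le[of "{..<d}" "\<lambda>i. [:1, - (\<omega> ^ i):]"] by (simp only: o_def finite_lessThan)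
    also have "\<dots> \<le> (\<Sum>i<d. 1)" by (intro sum_mono order_trans[OF degree_pCons_le]) simp
    finally show ?thesis by simp
  qed
  moreover have "degree ?q \<le> d"
    by (rule degree_diff_le) (simp_all add: degree_monom_le)
  moreover have "poly ?p z = poly ?q z" if z: "z \<in> ?A" for z
  proof (cases "z = 0")
    case True
    then show ?thesis using d by (simp add: poly_prod poly_monom)
  next
    case False
    then obtain j where j: "j < d" "z = \<omega> ^ j" using z by auto
    have "\<omega> ^ ((d - j) mod d) * \<omega> ^ j = 1"
      using j d by (cases "j = 0") (auto simp flip: power_add)
    then have "\<exists>i\<in>{..<d}. poly [:1, - (\<omega> ^ i):] z = 0"
      using j d by (intro bexI[of _ "(d - j) mod d"]) (auto simp: mult.commute)
    then have "poly ?p z = 0" by (simp add: poly_prod prod_zero_iff)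
    moreover have "z ^ d = 1"
      using d by (simp add: j flip: power_mult) (simp add: mult.commute power_mult)
    ultimately show ?thesis by (simp add: poly_monom)
  qed
  ultimately have "?p = ?q" by (intro poly_eqI_degree[of ?A]) auto
  then have "fps_of_poly ?p = fps_of_poly ?q" by simp
  then show ?thesis
    by (simp add: fps_of_poly_prod fps_of_poly_diff fps_of_poly_monom' fps_of_poly_pCons mult.commute
        del: fps_const_neg add: fps_const_neg[symmetric])
qed

lemma fps_prod_inverse:
  fixes f :: "'b \<Rightarrow> 'a :: field fps"
  shows "(\<Prod>i\<in>I. inverse (f i)) = inverse (\<Prod>i\<in>I. f i)"
  by (induction I rule: infinite_finite_induct) (simp_all add: fps_inverse_mult)

text \<open>
  With \<open>d * M\<close> variables every \<open>d\<close>-th root of unity occurs \<open>M\<close> times, so the generating function is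
  that of \<open>M\<close> variables equal to 1 with \<open>X\<close> replaced by \<open>X ^ d\<close>.
\<close>

lemma hsym_roots:
  assumes \<omega>: "primitive_root_of_unity d \<omega>"
  shows "hsym (\<lambda>i. \<omega> ^ i) (d * M) k =
    (if int d dvd k then hsym (\<lambda>_. 1) M (k div int d) else 0)"
proof -
  have d: "d > 0" "\<omega> ^ d = 1" using \<omega> by (auto simp: primitive_root_of_unity_def)
  let ?X = "fps_X :: complex fps"
  let ?f = "\<lambda>i. 1 - fps_const (\<omega> ^ i) * ?X"
  have "(\<Prod>i<d * M. ?f i) = (\<Prod>r<M. \<Prod>i\<in>{r * d..<r * d + d}. ?f i)"
    by (simp add: prod.nat_group mult.commute)
  also have "\<dots> = (\<Prod>r<M. \<Prod>i<d. ?f (r * d + i))"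
  proof (rule prod.cong[OF refl])
    fix r
    show "(\<Prod>i\<in>{r * d..<r * d + d}. ?f i) = (\<Prod>i<d. ?f (r * d + i))"
      by (rule prod.reindex_bij_witness[where i = "\<lambda>i. r * d + i" and j = "\<lambda>i. i - r * d"]) auto
  qed
  also have "\<dots> = (\<Prod>r<M. \<Prod>i<d. ?f i)"
    using d by (simp add: power_add power_mult mult.commute[of _ d])
  also have "\<dots> = (1 - ?X ^ d) ^ M" by (simp add: prod_one_minus_roots[OF \<omega>])
  finally have "(\<Prod>i<d * M. inverse (?f i)) = inverse ((1 - ?X ^ d) ^ M)"
    by (simp add: fps_prod_inverse)
  also have "\<dots> = inverse ((1 - ?X) ^ M) oo ?X ^ d"
    using d by (subst fps_inverse_compose)
      (simp_all add: fps_compose_power[symmetric] fps_compose_sub_distrib fps_nth_power_0)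
  also have "inverse ((1 - ?X) ^ M) = (\<Prod>i<M. inverse (1 - fps_const 1 * ?X))"
    by (simp add: fps_inverse_power)
  finally have *: "(\<Prod>i<d * M. inverse (?f i)) = (\<Prod>i<M. inverse (1 - fps_const 1 * ?X)) oo ?X ^ d" .
  show ?thesis
  proof (cases "k < 0")
    case True
    then show ?thesis using d by (auto simp: hsym_neg div_neg_pos_less0)
  next
    case False
    then obtain t where k: "k = int t" by (metis nonneg_int_cases not_less)
    show ?thesis
      unfolding k hsym_def * by (auto simp: fps_nth_compose_X_power zdiv_int[symmetric] nat_int)
  qed
qed

lemma det_block_diagonal:
  fixes C :: "nat \<Rightarrow> nat \<Rightarrow> 'a :: idom"
  shows "det (mat (d * B) (d * B) (\<lambda>(i, j). if i div B = j div B then C (i mod B) (j mod B) else 0))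
    = det (mat B B (\<lambda>(i, j). C i j)) ^ d"
proof (induction d)
  case (Suc d)
  let ?M = "\<lambda>d. mat (d * B) (d * B) (\<lambda>(i, j). if i div B = j div B then C (i mod B) (j mod B) else 0)"
  let ?C = "mat B B (\<lambda>(i, j). C i j)"
  have M: "?M (Suc d) = four_block_mat (?M d) (0\<^sub>m (d * B) B) (0\<^sub>m B (d * B)) ?C"
  proof (rule eq_matI)
    fix i j
    assume "i < dim_row (four_block_mat (?M d) (0\<^sub>m (d * B) B) (0\<^sub>m B (d * B)) ?C)"
      and "j < dim_col (four_block_mat (?M d) (0\<^sub>m (d * B) B) (0\<^sub>m B (d * B)) ?C)"
    then have ij: "i < d * B + B" "j < d * B + B" by auto
    then have B: "B > 0" by (cases B) auto
    have lt: "k div B < d" if "k < d * B" for k using that by (rule less_mult_imp_div_less)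
    have ge: "k div B = d \<and> k mod B = k - d * B" if "\<not> k < d * B" and "k < d * B + B" for k
    proof -
      have "k div B = d" by (rule div_nat_eqI) (use that in \<open>auto simp: mult.commute\<close>)
      moreover from this have "k mod B = k - d * B" by (metis minus_div_mult_eq_mod)
      ultimately show ?thesis by (rule conjI)
    qed
    have L: "?M (Suc d) $$ (i, j) = (if i div B = j div B then C (i mod B) (j mod B) else 0)"
      using ij by (subst index_mat) auto
    have R: "four_block_mat (?M d) (0\<^sub>m (d * B) B) (0\<^sub>m B (d * B)) ?C $$ (i, j) =
        (if i < d * B then if j < d * B then ?M d $$ (i, j) else 0
         else if j < d * B then 0 else ?C $$ (i - d * B, j - d * B))"
      using ij by (subst index_mat_four_block) auto
    show "?M (Suc d) $$ (i, j) = four_block_mat (?M d) (0\<^sub>m (d * B) B) (0\<^sub>m B (d * B)) ?C $$ (i, j)"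
      unfolding L R using ij lt[of i] lt[of j] ge[of i] ge[of j]
      by (cases "i < d * B"; cases "j < d * B") simp_all
  qed auto
  have "det (?M (Suc d)) = det (?M d) * det ?C"
    unfolding M by (rule det_four_block_mat_upper_right_zero[of _ "d * B" _ B]) auto
  then show ?case by (simp only: Suc.IH power_Suc2)
qed (simp add: det_dim_zero)

text \<open>
  The permutation \<open>p\<close> lists the indices \<open>x < d * B\<close> by residue mod \<open>d\<close> first. Applied to
  rows and columns it makes the matrix block diagonal, and the two signs cancel.
\<close>

lemma det_interleaved:
  fixes C :: "nat \<Rightarrow> nat \<Rightarrow> 'a :: idom"
  assumes d: "d > 0"
  shows "det (mat (d * B) (d * B) (\<lambda>(i, j). if i mod d = j mod d then C (i div d) (j div d) else 0))
    = det (mat B B (\<lambda>(i, j). C i j)) ^ d"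
proof -
  let ?N = "d * B"
  let ?A = "mat ?N ?N (\<lambda>(i, j). if i mod d = j mod d then C (i div d) (j div d) else 0)"
  define p where "p x = (if x < ?N then (x mod B) * d + x div B else x)" for x
  have p: "p x div d = x mod B" "p x mod d = x div B" "p x < ?N" if "x < ?N" for x
  proof -
    have B: "B > 0" using that by (cases B) auto
    have x: "x div B < d" using that by (simp add: less_mult_imp_div_less)
    have "x mod B < B" using B by simp
    then have "(x mod B + 1) * d \<le> B * d" by (intro mult_right_mono) auto
    then show "p x < ?N" using that x by (auto simp: p_def algebra_simps)
    show "p x div d = x mod B" "p x mod d = x div B" using that x d by (simp_all add: p_def)
  qed
  have inj: "inj_on p {0..<?N}"
  proof (rule inj_onI)
    fix x y assume "x \<in> {0..<?N}" "y \<in> {0..<?N}" "p x = p y"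
    then have "x mod B = y mod B" "x div B = y div B" using p[of x] p[of y] by auto
    then show "x = y" by (metis div_mult_mod_eq)
  qed
  have perm: "p permutes {0..<?N}"
  proof (rule bij_imp_permutes)
    show "bij_betw p {0..<?N} {0..<?N}"
      unfolding bij_betw_def
      by (intro conjI inj endo_inj_surj) (use p(3) in auto)
  qed (auto simp: p_def)
  let ?R = "mat ?N ?N (\<lambda>(i, j). ?A $$ (p i, j))"
  let ?D = "mat ?N ?N (\<lambda>(i, j). if i div B = j div B then C (i mod B) (j mod B) else 0)"
  have "det ?D = det (transpose_mat (mat ?N ?N (\<lambda>(i, j). transpose_mat ?R $$ (p i, j))))"
    by (rule arg_cong[where f = det], rule eq_matI) (auto simp: p)
  also have "\<dots> = det (mat ?N ?N (\<lambda>(i, j). transpose_mat ?R $$ (p i, j)))"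
    by (rule det_transpose[of _ ?N]) simp
  also have "\<dots> = signof p * det (transpose_mat ?R)"
    by (rule det_permute_rows) (use perm in auto)
  also have "det (transpose_mat ?R) = det ?R" by (rule det_transpose[of _ ?N]) simp
  also have "det ?R = signof p * det ?A" by (rule det_permute_rows) (use perm in auto)
  finally have "det ?D = det ?A" by (simp add: sign_def)
  then show ?thesis by (simp only: det_block_diagonal)
qed

lemma schur_at_ones: "schur lam m (\<lambda>_. 1) = of_nat (card (SSYT lam m))"
  by (simp add: schur_def)

text \<open>
  Since \<open>d\<close> divides the row length, the degree \<open>d * A - i + j\<close> is divisible by \<open>d\<close> iff
  \<open>i\<close> and \<open>j\<close> have the same residue, so the Jacobi-Trudi matrix has the interleaved form above; each
  block is the Jacobi-Trudi matrix of the smaller rectangle at \<open>(1, \<dots>, 1)\<close>, whose determinant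
  counts tableaux.
\<close>

lemma schur_rectangle_at_roots:
  assumes \<omega>: "primitive_root_of_unity d \<omega>"
  shows "schur (shape (d * B) (\<lambda>_. d * A)) (d * M) (\<lambda>i. \<omega> ^ i) =
    of_nat (card (SSYT (shape B (\<lambda>_. A)) M)) ^ d"
proof -
  have d: "d > 0" using \<omega> by (simp add: primitive_root_of_unity_def)
  let ?C = "\<lambda>i j. hsym (\<lambda>_. 1 :: complex) M (int A - int i + int j)"
  have entry: "hsym (\<lambda>i. \<omega> ^ i) (d * M) (int (d * A) - int i + int j) =
      (if i mod d = j mod d then ?C (i div d) (j div d) else 0)" for i j
  proof -
    define i' j' where "i' = i div d" "j' = j div d"
    define r s where "r = i mod d" "s = j mod d"
    have "int i = int d * int i' + int r" "int j = int d * int j' + int s"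
      by (simp_all add: i'_j'_def r_s_def flip: of_nat_mult of_nat_add)
    then have eq: "int (d * A) - int i + int j = int d * (int A - int i' + int j') + (int s - int r)"
      by (simp add: algebra_simps)
    have "r < d" "s < d" using d by (simp_all add: r_s_def)
    then have "int d dvd int s - int r \<longleftrightarrow> r = s"
      using zdvd_imp_le[of "int d" "int s - int r"] zdvd_imp_le[of "int d" "int r - int s"]
      by (cases r s rule: linorder_cases) (auto simp: dvd_diff_commute)
    then have "int d dvd int (d * A) - int i + int j \<longleftrightarrow> r = s"
      unfolding eq by (simp add: dvd_add_right_iff)
    then show ?thesis
      using d unfolding hsym_roots[OF \<omega>] eq by (auto simp: i'_j'_def r_s_def)
  qed
  have "schur (shape (d * B) (\<lambda>_. d * A)) (d * M) (\<lambda>i. \<omega> ^ i) =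
      det (mat (d * B) (d * B) (\<lambda>(i, j). if i mod d = j mod d then ?C (i div d) (j div d) else 0))"
    by (subst jacobi_trudi) (simp_all only: jt_mat_def entry order_refl)
  also have "\<dots> = det (jt_mat B (\<lambda>_. A) M (\<lambda>_. 1)) ^ d"
    using det_interleaved[OF d, of B ?C] by (simp only: jt_mat_def)
  also have "det (jt_mat B (\<lambda>_. A) M (\<lambda>_. 1 :: complex)) = of_nat (card (SSYT (shape B (\<lambda>_. A)) M))"
    by (subst jacobi_trudi[symmetric]) (simp_all add: schur_at_ones)
  finally show ?thesis .
qed

section \<open>Rectangular tableaux as plane partitions\<close>

text \<open>
  Plane partitions in an \<open>r \<times> c \<times> h\<close> box, written with increasing rows and columns.
\<close>

definition box_partitions :: "nat \<Rightarrow> nat \<Rightarrow> nat \<Rightarrow> (nat \<times> nat \<Rightarrow> nat) set" where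
  "box_partitions r c h = {P \<in> {..<r} \<times> {..<c} \<rightarrow>\<^sub>E {..h}.
     \<forall>i j i' j'. i \<le> i' \<and> j \<le> j' \<and> i' < r \<and> j' < c \<longrightarrow> P (i, j) \<le> P (i', j')}"

lemma box_partitionsD:
  assumes "P \<in> box_partitions r c h"
  shows "i < r \<Longrightarrow> j < c \<Longrightarrow> P (i, j) \<le> h"
    and "i \<le> i' \<Longrightarrow> j \<le> j' \<Longrightarrow> i' < r \<Longrightarrow> j' < c \<Longrightarrow> P (i, j) \<le> P (i', j')"
    and "P \<in> extensional ({..<r} \<times> {..<c})"
  using assms by (auto simp: box_partitions_def PiE_iff)

lemma finite_box_partitions [simp]: "finite (box_partitions r c h)"
  unfolding box_partitions_def
  by (rule finite_subset[of _ "{..<r} \<times> {..<c} \<rightarrow>\<^sub>E {..h}"]) (auto intro: finite_PiE)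

text \<open>
  Subtracting \<open>i\<close> from row \<open>i\<close> turns strictly increasing columns into weakly increasing ones. The
  entries then lie between 0 and \<open>m - b\<close>, because a column of length \<open>b\<close> leaves at least \<open>i\<close> values
  below and \<open>b - 1 - i\<close> values above the entry in row \<open>i\<close>.
\<close>

lemma card_rectangular_SSYT:
  assumes bm: "b \<le> m"
  shows "card (SSYT (shape b (\<lambda>_. a)) m) = card (box_partitions b a (m - b))"
proof -
  let ?S = "SSYT (shape b (\<lambda>_. a)) m" and ?D = "{..<b} \<times> {..<a}"
  define down where "down T = (\<lambda>c\<in>?D. T c - fst c)" for T :: "nat \<times> nat \<Rightarrow> nat"
  define up where "up P = (\<lambda>c\<in>?D. P c + fst c)" for P :: "nat \<times> nat \<Rightarrow> nat"
  have D: "young_diagram (shape b (\<lambda>_. a)) = ?D" by (simp add: young_diagram_shape_Sigma)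
  have grow: "T (i, j) + (i' - i) \<le> T (i', j)"
    if T: "T \<in> ?S" and "i \<le> i'" "i' < b" "j < a" for T i i' j
    using that(2,3)
  proof (induction rule: dec_induct)
    case (step k)
    then have "T (k, j) < T (Suc k, j)" using T that(4) unfolding SSYT_shape_iff by auto
    then show ?case using step by simp
  qed simp
  have low: "i \<le> T (i, j)" if "T \<in> ?S" "i < b" "j < a" for T i j
    using grow[of T 0 i j] that by simp
  have high: "T (i, j) \<le> (m - b) + i" if T: "T \<in> ?S" and ij: "i < b" "j < a" for T i j
  proof -
    have "T (b - 1, j) < m" using T ij unfolding SSYT_shape_iff by auto
    then show ?thesis using grow[OF T, of i "b - 1" j] ij bm by linarith
  qed
  have down: "down T \<in> box_partitions b a (m - b)" if T: "T \<in> ?S" for T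
  proof -
    have "T (i, j) - i \<le> T (i', j') - i'" if "i \<le> i'" "j \<le> j'" "i' < b" "j' < a" for i j i' j'
    proof -
      have "T (i, j) \<le> T (i, j')"
        using T that unfolding SSYT_shape_iff by (cases "j = j'") auto
      then show ?thesis using grow[OF T, of i i' j'] that by simp
    qed
    then show ?thesis using high[OF T]
      by (auto simp: box_partitions_def down_def PiE_iff le_diff_conv add.commute)
  qed
  have up: "up P \<in> ?S" if P: "P \<in> box_partitions b a (m - b)" for P
    unfolding SSYT_shape_iff D
  proof (intro conjI allI impI)
    fix i j assume "i < b" "j < a"
    then show "up P (i, j) < m" using box_partitionsD(1)[OF P, of i j] bm by (simp add: up_def)
  next
    fix i j' j assume "i < b" "j' < a" "j < j'"
    then show "up P (i, j) \<le> up P (i, j')" using box_partitionsD(2)[OF P, of i i j j'] by (simp add: up_def)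
  next
    fix i' i j assume "i' < b" "i < i'" "j < a"
    then show "up P (i, j) < up P (i', j)" using box_partitionsD(2)[OF P, of i i' j j] by (simp add: up_def)
  qed (simp add: up_def)
  have "bij_betw down ?S (box_partitions b a (m - b))"
  proof (rule bij_betw_byWitness[where f' = up])
    show "\<forall>T\<in>?S. up (down T) = T"
    proof (intro ballI ext)
      fix T c assume T: "T \<in> ?S"
      then have "T \<in> extensional ?D" unfolding SSYT_shape_iff D by blast
      then have "T c = undefined" if "c \<notin> ?D" using that by (rule extensional_arb)
      moreover have "fst c \<le> T c" if "c \<in> ?D" using low[OF T, of "fst c" "snd c"] that by auto
      ultimately show "up (down T) c = T c"
        by (cases "c \<in> ?D") (simp_all add: up_def down_def)
    qed
    show "\<forall>P\<in>box_partitions b a (m - b). down (up P) = P"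
    proof (intro ballI ext)
      fix P c assume P: "P \<in> box_partitions b a (m - b)"
      have "P c = undefined" if "c \<notin> ?D"
        using box_partitionsD(3)[OF P] that by (rule extensional_arb)
      then show "down (up P) c = P c"
        by (cases "c \<in> ?D") (simp_all add: up_def down_def)
    qed
  qed (use down up in auto)
  then show ?thesis by (rule bij_betw_same_card)
qed

lemma block_less:
  fixes u k x r :: nat
  assumes "u < k" "x < r"
  shows "u * r + x < k * r"
proof -
  have "u * r + x < Suc u * r" using assms by simp
  also have "\<dots> \<le> k * r" using assms by (intro mult_right_mono) auto
  finally show ?thesis .
qed

lemma staircase_card: "2 * card (SIGMA u:{..<k}. {..<k - u}) = k * (k + 1)"
proof -
  have "card (SIGMA u:{..<k}. {..<k - u}) = (\<Sum>u<k. k - u)" by simp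
  also have "\<dots> = (\<Sum>u<k. Suc u)"
    by (rule sum.reindex_bij_witness[where i = "\<lambda>u. k - Suc u" and j = "\<lambda>u. k - Suc u"]) auto
  also have "2 * \<dots> = k * (k + 1)" by (induction k) (auto simp: algebra_simps)
  finally show ?thesis .
qed

text \<open>
  Cut the large \<open>k r \<times> k c\<close> rectangle into \<open>k\<^sup>2\<close> blocks \<open>(u, v)\<close> of size \<open>r \<times> c\<close>. A block with
  \<open>u + v < k\<close> carries an arbitrary plane partition raised by \<open>h * (u + v)\<close>, every other block is
  constantly \<open>k * h\<close>: neighbouring blocks then occupy consecutive height ranges, so the result is
  monotone, and the blocks can be read off. There are \<open>k * (k + 1) / 2\<close> free blocks; the inequality is
  squared to avoid this division.
\<close>

lemma box_partitions_stack:
  "card (box_partitions r c h) ^ (k * (k + 1)) \<le> card (box_partitions (k * r) (k * c) (k * h)) ^ 2"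
proof -
  let ?I = "SIGMA u:{..<k}. {..<k - u}" and ?D = "{..<k * r} \<times> {..<k * c}"
  define stack where "stack Q = (\<lambda>(i, j)\<in>?D.
     if i div r + j div c < k then h * (i div r + j div c) + Q (i div r, j div c) (i mod r, j mod c)
     else h * k)" for Q :: "nat \<times> nat \<Rightarrow> nat \<times> nat \<Rightarrow> nat"
  have in_I: "(u, v) \<in> ?I \<longleftrightarrow> u + v < k" for u v by auto
  have stack: "stack Q \<in> box_partitions (k * r) (k * c) (k * h)"
    if Q: "Q \<in> ?I \<rightarrow>\<^sub>E box_partitions r c h" for Q
  proof -
    have QI: "Q (u, v) \<in> box_partitions r c h" if "u + v < k" for u v
      using Q that in_I by (metis PiE_mem)
    let ?f = "\<lambda>i j. if i div r + j div c < k then h * (i div r + j div c) + Q (i div r, j div c) (i mod r, j mod c)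
     else h * k"
    have bound: "Q (u, v) (i mod r, j mod c) \<le> h" if "u + v < k" "i < k * r" "j < k * c" for u v i j
    proof -
      have "r > 0" "c > 0" using that by (auto intro!: Nat.gr0I)
      then show ?thesis by (intro box_partitionsD(1)[OF QI[OF that(1)]]) auto
    qed
    \<comment> \<open>Block \<open>(u, v)\<close> takes values between \<open>h * min k (u + v)\<close> and \<open>h * min k (u + v + 1)\<close>.\<close>
    have top: "?f i j \<le> h * min k (Suc (i div r + j div c))" if "i < k * r" "j < k * c" for i j
    proof (cases "i div r + j div c < k")
      case True
      have "?f i j \<le> h * (i div r + j div c) + h" using bound[OF True that] True by simp
      also have "\<dots> = h * min k (Suc (i div r + j div c))" using True by (simp add: min_absorb2)
      finally show ?thesis .
    qed simp
    have bot: "h * min k (i div r + j div c) \<le> ?f i j" for i j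
      by (auto simp: min_def)
    have "?f i j \<le> ?f i' j'" if le: "i \<le> i'" "j \<le> j'" "i' < k * r" "j' < k * c" for i j i' j'
    proof (cases "i div r = i' div r \<and> j div c = j' div c")
      case True
      have "i mod r \<le> i' mod r" "j mod c \<le> j' mod c"
        using True le by (metis add_le_cancel_left mult_div_mod_eq)+
      moreover have "r > 0" "c > 0" using le by (auto intro!: Nat.gr0I)
      ultimately have "Q (u, v) (i mod r, j mod c) \<le> Q (u, v) (i' mod r, j' mod c)" if "u + v < k" for u v
        by (intro box_partitionsD(2)[OF QI[OF that]]) auto
      then show ?thesis using True by simp
    next
      case False
      then have "Suc (i div r + j div c) \<le> i' div r + j' div c"
        using div_le_mono[OF le(1), of r] div_le_mono[OF le(2), of c] by linarith
      then have "h * min k (Suc (i div r + j div c)) \<le> h * min k (i' div r + j' div c)"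
        by (intro mult_left_mono) auto
      then show ?thesis using top[of i j] bot[of i' j'] le by linarith
    qed
    moreover have "?f i j \<le> k * h" if "i < k * r" "j < k * c" for i j
    proof -
      have "h * min k (Suc (i div r + j div c)) \<le> h * k" by (intro mult_left_mono) auto
      then show ?thesis using order_trans[OF top[OF that]] by (simp only: mult.commute)
    qed
    ultimately show ?thesis
      by (auto simp: box_partitions_def stack_def PiE_iff split del: if_split)
  qed
  have "inj_on stack (?I \<rightarrow>\<^sub>E box_partitions r c h)"
  proof (rule inj_onI)
    fix Q Q' assume Q: "Q \<in> ?I \<rightarrow>\<^sub>E box_partitions r c h" and Q': "Q' \<in> ?I \<rightarrow>\<^sub>E box_partitions r c h"
      and eq: "stack Q = stack Q'"
    show "Q = Q'"
    proof (rule PiE_ext[OF Q Q'])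
      fix p assume p: "p \<in> ?I"
      then obtain u v where uv: "p = (u, v)" "u + v < k" by auto
      have mem: "Q p \<in> box_partitions r c h" "Q' p \<in> box_partitions r c h"
        using PiE_mem[OF Q p] PiE_mem[OF Q' p] .
      show "Q p = Q' p"
      proof (rule extensionalityI[OF box_partitionsD(3)[OF mem(1)] box_partitionsD(3)[OF mem(2)]])
        fix z assume "z \<in> {..<r} \<times> {..<c}"
        then obtain x y where z: "z = (x, y)" "x < r" "y < c" by auto
        have "u * r + x < k * r" "v * c + y < k * c"
          using uv z by (auto intro!: block_less)
        then show "Q p z = Q' p z"
          using fun_cong[OF eq, of "(u * r + x, v * c + y)"] uv z
          by (simp add: stack_def)
      qed
    qed
  qed
  then have "card (?I \<rightarrow>\<^sub>E box_partitions r c h) \<le> card (box_partitions (k * r) (k * c) (k * h))"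
    using stack by (intro card_inj_on_le) auto
  then have "card (box_partitions r c h) ^ card ?I \<le> card (box_partitions (k * r) (k * c) (k * h))"
    by (simp add: card_PiE)
  then have "(card (box_partitions r c h) ^ card ?I) ^ 2 \<le> card (box_partitions (k * r) (k * c) (k * h)) ^ 2"
    by (intro power_mono) auto
  then show ?thesis
    by (simp only: staircase_card mult.commute[of _ 2] flip: power_mult)
qed

lemma two_le_card_box_partitions:
  assumes "r > 0" "c > 0" "h > 0"
  shows "2 \<le> card (box_partitions r c h)"
proof -
  let ?K = "\<lambda>v. (\<lambda>_\<in>{..<r} \<times> {..<c}. v :: nat)"
  have "?K 0 (0, 0) \<noteq> ?K 1 (0, 0)" using assms by simp
  then have "?K 0 \<noteq> ?K 1" by metis
  then have "card {?K 0, ?K 1} = 2" by simp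
  moreover have "{?K 0, ?K 1} \<subseteq> box_partitions r c h"
    using assms by (auto simp: box_partitions_def)
  ultimately show ?thesis by (metis card_mono finite_box_partitions)
qed

lemma card_empty_shape_SSYT:
  assumes "a = 0 \<or> b = 0"
  shows "card (SSYT (shape b (\<lambda>_. a)) m) = 1"
proof -
  have "young_diagram (shape b (\<lambda>_. a)) = {}" using assms by (auto simp: young_diagram_def)
  then have "SSYT (shape b (\<lambda>_. a)) m = {\<lambda>_. undefined}" by (auto simp: SSYT_def)
  then show ?thesis by simp
qed

section \<open>Sizes of orbits from numbers of fixed points\<close>

text \<open>
  The Dirichlet (Moebius) inverse of summation over divisors, in recursive form: if \<open>F j\<close> counts the points
  fixed by the \<open>j\<close>-th power of a generator, this counts the points whose orbit has size \<open>j\<close>.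
\<close>

fun divisor_inverse :: "(nat \<Rightarrow> int) \<Rightarrow> nat \<Rightarrow> int" where
  "divisor_inverse F j = F j - (\<Sum>E\<in>{E. E dvd j \<and> E < j}. divisor_inverse F E)"

declare divisor_inverse.simps [simp del]

lemma proper_divisors: "(j :: nat) > 0 \<Longrightarrow> {E. E dvd j} = insert j {E. E dvd j \<and> E < j}"
  by (auto dest: dvd_imp_le)

lemma sum_divisor_inverse:
  assumes "j > 0"
  shows "(\<Sum>E | E dvd j. divisor_inverse F E) = F j"
  using divisor_inverse.simps[of F j] by (simp add: proper_divisors[OF assms])

text \<open>
  By induction the \<open>T E\<close> for proper divisors \<open>E\<close> of \<open>D\<close> are nonnegative and hence at most \<open>F E\<close>, so
  subtracting them from \<open>F D\<close> leaves something nonnegative.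
\<close>

lemma nonneg_if_dominates_divisors:
  fixes F T :: "nat \<Rightarrow> int"
  assumes T: "\<And>j. j dvd n \<Longrightarrow> (\<Sum>E | E dvd j. T E) = F j"
    and dom: "\<And>j. j dvd n \<Longrightarrow> (\<Sum>E\<in>{E. E dvd j \<and> E < j}. F E) \<le> F j"
    and n: "n > 0" and "D dvd n"
  shows "0 \<le> T D"
  using \<open>D dvd n\<close>
proof (induction D rule: less_induct)
  case (less D)
  have split: "F j = T j + (\<Sum>E\<in>{E. E dvd j \<and> E < j}. T E)" if "j dvd n" for j
    using T[OF that] proper_divisors[of j] that n by (simp add: dvd_pos_nat)
  have "(\<Sum>E\<in>{E. E dvd D \<and> E < D}. T E) \<le> (\<Sum>E\<in>{E. E dvd D \<and> E < D}. F E)"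
  proof (rule sum_mono)
    fix E assume "E \<in> {E. E dvd D \<and> E < D}"
    then have E: "E dvd n" "E < D" using less.prems dvd_trans by auto
    have "0 \<le> (\<Sum>E'\<in>{E'. E' dvd E \<and> E' < E}. T E')"
      using E less.IH dvd_trans by (intro sum_nonneg) fastforce
    then show "T E \<le> F E" using split[OF E(1)] by simp
  qed
  then show ?case using dom[OF less.prems] split[OF less.prems] by simp
qed

lemma square_le_power_2: "D ^ 2 \<le> 2 ^ (D + 1)" for D :: nat
proof (induction D rule: less_induct)
  case (less D)
  show ?case
  proof (cases "D < 4")
    case True
    then have "D = 0 \<or> D = 1 \<or> D = 2 \<or> D = 3" by auto
    then show ?thesis by (auto simp: power2_eq_square)
  next
    case False
    then obtain d where d: "D = Suc d" "3 \<le> d" by (cases D) auto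
    have "3 * d \<le> d * d" using d by (intro mult_right_mono) auto
    moreover have "D ^ 2 = d * d + 2 * d + 1" by (simp add: d power2_eq_square)
    ultimately have "D ^ 2 \<le> 2 * d ^ 2" using d(2) unfolding power2_eq_square by linarith
    also have "\<dots> \<le> 2 * 2 ^ (d + 1)" using less[of d] d by simp
    finally show ?thesis using d by simp
  qed
qed

lemma sixth_power_le_power_2:
  fixes D :: nat
  assumes "D \<ge> 2"
  shows "D ^ 6 \<le> 2 ^ (D * (D + 1))"
proof (cases "D = 2")
  case False
  have "D ^ 6 \<le> D ^ (2 * D)" using assms False by (intro power_increasing) auto
  also have "\<dots> = (D ^ 2) ^ D" by (simp add: power_mult)
  also have "\<dots> \<le> (2 ^ (D + 1)) ^ D" by (intro power_mono square_le_power_2) auto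
  also have "\<dots> = 2 ^ (D * (D + 1))" by (simp only: mult.commute flip: power_mult)
  finally show ?thesis .
qed simp

text \<open>
  For a proper divisor \<open>E\<close> of \<open>D\<close> the quotient is at least 2, so \<open>F E ^ 3 \<le> F D ^ 2\<close>. There are fewer
  than \<open>D\<close> proper divisors, so \<open>D * F E \<le> F D\<close> suffices; in sixth powers this reduces to
  \<open>D ^ 6 \<le> F D ^ 2\<close>, which comes from comparing \<open>F D\<close> with \<open>F 1\<close>.
\<close>

lemma growth_dominates_divisors:
  fixes F :: "nat \<Rightarrow> nat"
  assumes n: "n > 0" and F1: "2 ^ n \<le> F 1"
    and growth: "\<And>E k. E * k dvd n \<Longrightarrow> F E ^ (k + 1) \<le> F (E * k) ^ 2"
    and D: "D dvd n"
  shows "(\<Sum>E\<in>{E. E dvd D \<and> E < D}. F E) \<le> F D"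
proof (cases "D \<ge> 2")
  case True
  have Dn: "D \<le> n" using D n by (rule dvd_imp_le)
  have pos: "F E > 0" if "E dvd n" for E
  proof -
    have "(2 ^ n) ^ (E + 1) \<le> F 1 ^ (E + 1)" using F1 by (rule power_mono) simp
    also have "\<dots> \<le> F E ^ 2" using growth[of 1 E] that by simp
    finally have "0 < F E ^ 2" by (rule less_le_trans[rotated]) simp
    then show ?thesis by simp
  qed
  have "2 ^ (D * (D + 1)) \<le> (2 :: nat) ^ (n * (D + 1))"
    using Dn by (intro power_increasing mult_right_mono) auto
  also have "\<dots> = (2 ^ n) ^ (D + 1)" by (simp only: power_mult)
  also have "\<dots> \<le> F 1 ^ (D + 1)" using F1 by (rule power_mono) simp
  also have "\<dots> \<le> F D ^ 2" using growth[of 1 D] D by simp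
  finally have D6: "D ^ 6 \<le> F D ^ 2" using sixth_power_le_power_2[OF True] by simp
  have each: "D * F E \<le> F D" if E: "E dvd D" "E < D" for E
  proof -
    obtain k where k: "D = E * k" using E by blast
    then have "k \<ge> 2" using E True by (cases "k = 0 \<or> k = 1") auto
    have "F E > 0" using pos E D dvd_trans by blast
    then have "F E ^ 3 \<le> F E ^ (k + 1)" using \<open>k \<ge> 2\<close> by (intro power_increasing) auto
    also have "\<dots> \<le> F D ^ 2" using growth[of E k] k D by simp
    finally have "F E ^ 3 \<le> F D ^ 2" .
    then have "(F E ^ 3) ^ 2 \<le> (F D ^ 2) ^ 2" by (rule power_mono) simp
    then have "D ^ 6 * F E ^ 6 \<le> F D ^ 2 * F D ^ 4"
      using D6 by (intro mult_mono) (simp_all flip: power_mult)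
    then have "(D * F E) ^ 6 \<le> F D ^ 6" by (simp add: power_mult_distrib flip: power_add)
    then show ?thesis by simp
  qed
  have "D * (\<Sum>E\<in>{E. E dvd D \<and> E < D}. F E) \<le> (\<Sum>E\<in>{E. E dvd D \<and> E < D}. F D)"
    unfolding sum_distrib_left by (rule sum_mono) (use each in auto)
  also have "\<dots> \<le> D * F D"
  proof -
    have "card {E. E dvd D \<and> E < D} \<le> card {..<D}" by (rule card_mono) auto
    then have "card {E. E dvd D \<and> E < D} * F D \<le> D * F D" by (intro mult_right_mono) simp_all
    then show ?thesis by (simp only: sum_constant of_nat_id)
  qed
  finally show ?thesis by (rule mult_left_le_imp_le) (use True in simp)
next
  case False
  then have none: "{E. E dvd D \<and> E < D} = {}" using D n by (cases "D = 0") auto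
  show ?thesis unfolding none by simp
qed

lemma sum_root_powers_multiples:
  assumes \<omega>: "primitive_root_of_unity n \<omega>" and E: "E dvd n"
  shows "(\<Sum>k\<in>{k. k < n \<and> E dvd k}. \<omega> ^ (k * i)) = (if n dvd E * i then of_nat (n div E) else 0)"
proof -
  have n: "n > 0" using \<omega> by (simp add: primitive_root_of_unity_def)
  obtain q where q: "n = E * q" using E by blast
  then have "E > 0" using n by (cases E) auto
  let ?z = "\<omega> ^ (E * i)"
  have "(\<Sum>k\<in>{k. k < n \<and> E dvd k}. \<omega> ^ (k * i)) = (\<Sum>t<q. ?z ^ t)"
    using \<open>E > 0\<close>
    by (intro sum.reindex_bij_witness[where i = "\<lambda>t. E * t" and j = "\<lambda>k. k div E"])
      (auto simp: q mult_ac simp flip: power_mult)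
  also have "\<dots> = (if n dvd E * i then of_nat q else 0)"
  proof (cases "?z = 1")
    case True
    then show ?thesis using root_power_eq_1_iff[OF \<omega>, of "E * i"] by simp
  next
    case False
    have "?z ^ q = 1"
      using root_power_eq_1_iff[OF \<omega>, of "E * i * q"] by (simp add: power_mult q)
    then show ?thesis
      using False root_power_eq_1_iff[OF \<omega>, of "E * i"] by (simp add: geometric_sum)
  qed
  also have "q = n div E" using q \<open>E > 0\<close> by simp
  finally show ?thesis .
qed

text \<open>
  Averaging \<open>\<omega> ^ (k * (s x + i))\<close> over \<open>k\<close> detects whether \<open>n\<close> divides \<open>s x + i\<close>. The other side is
  obtained by expanding the given values and summing over the multiples \<open>k\<close> of each \<open>E\<close>; this sum
  vanishes unless \<open>n div E\<close> divides \<open>i\<close>, whence the substitution \<open>g = n div E\<close>.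
\<close>

lemma residue_count_from_root_values:
  fixes T :: "nat \<Rightarrow> int"
  assumes \<omega>: "primitive_root_of_unity n \<omega>" and X: "finite X"
    and vals: "\<And>k. (\<Sum>x\<in>X. \<omega> ^ (k * s x)) = of_int (\<Sum>E | E dvd gcd k n. T E)"
    and i: "i dvd n"
  shows "int n * int (card {x \<in> X. n dvd s x + i}) = (\<Sum>g | g dvd i. T (n div g) * int g)"
proof -
  have n: "n > 0" using \<omega> by (simp add: primitive_root_of_unity_def)
  have all: "(\<Sum>k<n. \<omega> ^ (k * j)) = (if n dvd j then of_nat n else 0)" for j
    using sum_root_powers_multiples[OF \<omega>, of 1 j] by (simp add: lessThan_def)
  have "(\<Sum>k<n. \<omega> ^ (k * i) * (\<Sum>x\<in>X. \<omega> ^ (k * s x))) = (\<Sum>x\<in>X. \<Sum>k<n. \<omega> ^ (k * (s x + i)))"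
    unfolding sum_distrib_left by (subst sum.swap) (simp add: distrib_left power_add mult.commute)
  also have "\<dots> = of_nat (n * card {x \<in> X. n dvd s x + i})"
    unfolding all using X by (simp add: sum.If_cases Int_def)
  finally have L: "(\<Sum>k<n. \<omega> ^ (k * i) * (\<Sum>x\<in>X. \<omega> ^ (k * s x))) = of_nat (n * card {x \<in> X. n dvd s x + i})" .
  have dv: "{E. E dvd gcd k n} = {E \<in> {E. E dvd n}. E dvd k}" for k by auto
  have fin: "finite {E. E dvd n}" using n by simp
  have "(\<Sum>k<n. \<omega> ^ (k * i) * (\<Sum>x\<in>X. \<omega> ^ (k * s x))) =
      (\<Sum>k<n. \<Sum>E\<in>{E. E dvd n}. if E dvd k then \<omega> ^ (k * i) * of_int (T E) else 0)"
    unfolding vals dv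
    by (simp only: of_int_sum sum_distrib_left sum.inter_filter[OF fin]) (intro sum.cong refl, simp)
  also have "\<dots> = (\<Sum>E\<in>{E. E dvd n}. \<Sum>k<n. if E dvd k then \<omega> ^ (k * i) * of_int (T E) else 0)"
    by (rule sum.swap)
  also have "\<dots> = (\<Sum>E\<in>{E. E dvd n}. of_int (T E) * (\<Sum>k\<in>{k. k < n \<and> E dvd k}. \<omega> ^ (k * i)))"
  proof (rule sum.cong[OF refl])
    fix E
    have "{k. k < n \<and> E dvd k} = {k \<in> {..<n}. E dvd k}" by auto
    then show "(\<Sum>k<n. if E dvd k then \<omega> ^ (k * i) * of_int (T E) else 0) =
        of_int (T E) * (\<Sum>k\<in>{k. k < n \<and> E dvd k}. \<omega> ^ (k * i))"
      by (simp add: sum_distrib_left mult.commute flip: sum.inter_filter)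
  qed
  also have "\<dots> = (\<Sum>E\<in>{E. E dvd n}. of_int (if n dvd E * i then T E * int (n div E) else 0))"
    by (rule sum.cong[OF refl]) (simp add: sum_root_powers_multiples[OF \<omega>])
  also have "\<dots> = of_int (\<Sum>E\<in>{E. E dvd n}. if n dvd E * i then T E * int (n div E) else 0)"
    by simp
  also have "(\<Sum>E\<in>{E. E dvd n}. if n dvd E * i then T E * int (n div E) else 0) =
      (\<Sum>E\<in>{E \<in> {E. E dvd n}. n dvd E * i}. T E * int (n div E))"
    by (rule sum.inter_filter[OF fin, symmetric])
  also have "\<dots> = (\<Sum>g | g dvd i. T (n div g) * int g)"
  proof (rule sum.reindex_bij_witness[where i = "\<lambda>g. n div g" and j = "\<lambda>E. n div E"])
    fix E assume E: "E \<in> {E \<in> {E. E dvd n}. n dvd E * i}"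
    then obtain q where q: "n = E * q" by auto
    then have "E > 0" "q > 0" using n by auto
    then have [simp]: "n div E = q" "n div q = E" using q by simp_all
    show "n div (n div E) = E" by simp
    then show "T (n div (n div E)) * int (n div E) = T E * int (n div E)" by simp
    show "n div E \<in> {g. g dvd i}" using E q \<open>E > 0\<close> by simp
  next
    fix g assume "g \<in> {g. g dvd i}"
    then have g: "g dvd i" "g dvd n" using i dvd_trans by auto
    then obtain q where q: "n = g * q" by auto
    then have "g > 0" "q > 0" using n by auto
    then have [simp]: "n div g = q" "n div q = g" using q by simp_all
    show "n div (n div g) = g" by simp
    show "n div g \<in> {E \<in> {E. E dvd n}. n dvd E * i}" using q g(1) by (simp add: mult.commute)
  qed
  finally have "of_int (int n * int (card {x \<in> X. n dvd s x + i})) =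
      (of_int (\<Sum>g | g dvd i. T (n div g) * int g) :: complex)"
    using L by simp
  then show ?thesis by (simp only: of_int_eq_iff)
qed

text \<open>
  The preceding identity shows, by induction on the divisor \<open>g\<close> of \<open>n\<close>, that \<open>n\<close> divides
  \<open>T (n div g) * g\<close>, since all other summands for \<open>i = g\<close> belong to smaller divisors. Taking
  \<open>g = n div D\<close> gives the claim.
\<close>

lemma dvd_orbit_size_total:
  fixes T :: "nat \<Rightarrow> int"
  assumes \<omega>: "primitive_root_of_unity n \<omega>" and X: "finite X"
    and vals: "\<And>k. (\<Sum>x\<in>X. \<omega> ^ (k * s x)) = of_int (\<Sum>E | E dvd gcd k n. T E)"
    and D: "D dvd n"
  shows "int D dvd T D"
proof -
  have n: "n > 0" using \<omega> by (simp add: primitive_root_of_unity_def)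
  have dvd: "int n dvd T (n div g) * int g" if "g dvd n" for g
    using that
  proof (induction g rule: less_induct)
    case (less g)
    have g: "g > 0" using less.prems n by (rule dvd_pos_nat[rotated])
    have "int n dvd (\<Sum>h | h dvd g. T (n div h) * int h)"
      unfolding residue_count_from_root_values[OF \<omega> X vals less.prems, symmetric] by simp
    moreover have "int n dvd (\<Sum>h\<in>{h. h dvd g \<and> h < g}. T (n div h) * int h)"
      using less.IH less.prems dvd_trans by (intro dvd_sum) blast
    ultimately show ?case
      unfolding proper_divisors[OF g] by (simp add: dvd_add_left_iff)
  qed
  obtain g where g: "n = D * g" using D by blast
  then have "g > 0" "D > 0" using n by auto
  then have "int D * int g dvd T D * int g" using dvd[of g] g by simp
  then show ?thesis using \<open>g > 0\<close> by simp
qed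

section \<open>Cyclic actions with prescribed orbits\<close>

lemma generator_ord:
  assumes "cyclic_of_order n G \<sigma>"
  shows "group.ord G \<sigma> = n"
proof -
  interpret group G using assms by (simp add: cyclic_of_order_def)
  show "ord \<sigma> = n"
    using assms generate_pow_card[of \<sigma>] by (simp add: cyclic_of_order_def order_def)
qed

text \<open>
  The model of the action is the disjoint union \<open>Y\<close> of \<open>orbs D\<close> cycles of length \<open>D\<close>, with \<open>\<sigma>\<close>
  rotating every cycle by one step; it is carried to \<open>X\<close> along any bijection. A rotation by \<open>e\<close>
  depends only on \<open>e\<close> mod \<open>n\<close>, so it does not matter which exponent \<open>dlog g\<close> is chosen for a
  group element \<open>g\<close>.
\<close>

lemma cyclic_action_with_orbit_counts:
  fixes G :: "('g, 'z) monoid_scheme" and X :: "'a set" and orbs :: "nat \<Rightarrow> nat"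
  assumes G: "cyclic_of_order n G \<sigma>" and n: "n > 0"
    and X: "finite X" "card X = (\<Sum>D | D dvd n. orbs D * D)"
  shows "\<exists>\<phi>. group_action G X \<phi> \<and>
    (\<forall>k::int. card (invariants X \<phi> (\<sigma> [^]\<^bsub>G\<^esub> k)) = (\<Sum>D | D dvd n \<and> int D dvd k. orbs D * D))"
proof -
  interpret group G using G by (simp add: cyclic_of_order_def)
  have \<sigma>: "\<sigma> \<in> carrier G" and gen: "generate G {\<sigma>} = carrier G"
    using G by (simp_all add: cyclic_of_order_def)
  define Y where "Y = (SIGMA D:{D. D dvd n}. {..<orbs D} \<times> {..<D})"
  define rot where "rot e = (\<lambda>(D, t, r). (D :: nat, t :: nat, nat ((int r + e) mod int D)))"
    for e :: int
  have fin: "finite {D. D dvd n}" using n by simp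
  have "card Y = card X" unfolding Y_def X(2) using fin by (subst card_SigmaI) (auto simp: card_cartesian_product)
  moreover have "finite Y" unfolding Y_def using fin by auto
  ultimately obtain h where h: "bij_betw h X Y" using X(1) finite_same_card_bij by metis
  have rot_Y: "rot e y \<in> Y"
    and rot_rot: "rot e (rot e' y) = rot (e + e') y"
    and rot_0: "rot 0 y = y"
    and rot_cong: "int n dvd e - e' \<Longrightarrow> rot e y = rot e' y"
    and rot_fix: "rot e y = y \<longleftrightarrow> int (fst y) dvd e"
    if y: "y \<in> Y" for y e e'
  proof -
    obtain D t r where y_eq: "y = (D, t, r)" by (cases y)
    then have D: "D dvd n" "t < orbs D" "r < D" using y by (auto simp: Y_def)
    then show "rot e y \<in> Y"
      by (simp add: y_eq rot_def Y_def nat_less_iff)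
    show "rot e (rot e' y) = rot (e + e') y"
      using D by (simp add: y_eq rot_def mod_add_left_eq mod_add_right_eq algebra_simps)
    show "rot 0 y = y" using D by (simp add: y_eq rot_def)
    show "rot e y = rot e' y" if "int n dvd e - e'"
    proof -
      have "int D dvd e - e'" using D(1) that by (meson dvd_trans of_nat_dvd_iff)
      then have "(int r + e) mod int D = (int r + e') mod int D"
        by (simp add: mod_eq_dvd_iff)
      then show ?thesis by (simp add: y_eq rot_def)
    qed
    have "rot e y = y \<longleftrightarrow> (int r + e) mod int D = int r mod int D"
      using D by (simp add: y_eq rot_def nat_eq_iff)
    also have "\<dots> \<longleftrightarrow> int D dvd e" by (simp add: mod_eq_dvd_iff)
    finally show "rot e y = y \<longleftrightarrow> int (fst y) dvd e" by (simp add: y_eq)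
  qed
  define act where "act e x = inv_into X h (rot e (h x))" for e x
  have hY: "h x \<in> Y" if "x \<in> X" for x using h that by (rule bij_betwE[THEN bspec])
  have h_act: "h (act e x) = rot e (h x)" and act_X: "act e x \<in> X" if "x \<in> X" for e x
  proof -
    have "rot e (h x) \<in> h ` X" using rot_Y[OF hY[OF that]] h by (simp add: bij_betw_def)
    then show "h (act e x) = rot e (h x)" "act e x \<in> X"
      unfolding act_def by (auto intro: f_inv_into_f inv_into_into)
  qed
  have h_eq: "x = x'" if "x \<in> X" "x' \<in> X" "h x = h x'" for x x'
    using h that by (auto simp: bij_betw_def inj_on_def)
  have act_act: "act e (act e' x) = act (e + e') x" if "x \<in> X" for e e' x
    by (rule h_eq) (simp_all add: that act_X h_act rot_rot hY)
  have act_0: "act 0 x = x" if "x \<in> X" for x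
    by (rule h_eq) (simp_all add: that act_X h_act rot_0 hY)
  have act_cong: "act e x = act e' x" if "x \<in> X" "int n dvd e - e'" for e e' x
    using rot_cong[OF hY[OF that(1)] that(2)] by (simp add: act_def)
  have act_fix: "act e x = x \<longleftrightarrow> int (fst (h x)) dvd e" if "x \<in> X" for e x
    using rot_fix[OF hY[OF that], of e] h_act[OF that, of e] h_eq[OF act_X[OF that] that] by metis
  have "\<exists>e::int. g = \<sigma> [^]\<^bsub>G\<^esub> e" if "g \<in> carrier G" for g
    using that generate_pow[OF \<sigma>] unfolding gen by auto
  then obtain dlog :: "'g \<Rightarrow> int" where dlog: "\<And>g. g \<in> carrier G \<Longrightarrow> g = \<sigma> [^]\<^bsub>G\<^esub> dlog g" by metis
  define \<phi> where "\<phi> g = (\<lambda>x\<in>X. act (dlog g) x)" for g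
  have \<phi>: "\<phi> (\<sigma> [^]\<^bsub>G\<^esub> e) x = act e x" if "x \<in> X" for e :: int and x
  proof -
    have "\<sigma> [^]\<^bsub>G\<^esub> dlog (\<sigma> [^]\<^bsub>G\<^esub> e) = \<sigma> [^]\<^bsub>G\<^esub> e" using dlog[of "\<sigma> [^]\<^bsub>G\<^esub> e"] \<sigma> by simp
    then have "int n dvd dlog (\<sigma> [^]\<^bsub>G\<^esub> e) - e"
      using int_pow_eq[OF \<sigma>, of e "dlog (\<sigma> [^]\<^bsub>G\<^esub> e)"] generator_ord[OF G] by simp
    then have "act (dlog (\<sigma> [^]\<^bsub>G\<^esub> e)) x = act e x" by (rule act_cong[OF that])
    then show ?thesis using that by (simp add: \<phi>_def)
  qed
  have Bij: "\<phi> g \<in> Bij X" for g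
  proof -
    have "bij_betw (\<phi> g) X X"
      by (rule bij_betw_byWitness[where f' = "act (- dlog g)"])
        (auto simp: \<phi>_def act_act act_0 act_X)
    then show ?thesis by (simp add: Bij_def \<phi>_def)
  qed
  have "group_hom G (BijGroup X) \<phi>"
  proof (intro group_hom.intro group_hom_axioms.intro homI)
    fix g g' assume g: "g \<in> carrier G" "g' \<in> carrier G"
    then have gg: "g \<otimes>\<^bsub>G\<^esub> g' = \<sigma> [^]\<^bsub>G\<^esub> (dlog g + dlog g')"
      using dlog[of g] dlog[of g'] \<sigma> by (metis int_pow_mult)
    have "\<phi> (g \<otimes>\<^bsub>G\<^esub> g') = compose X (\<phi> g) (\<phi> g')"
    proof
      fix x
      show "\<phi> (g \<otimes>\<^bsub>G\<^esub> g') x = compose X (\<phi> g) (\<phi> g') x"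
        by (cases "x \<in> X")
          (simp_all add: gg \<phi> compose_def, simp_all add: \<phi>_def act_X act_act)
    qed
    then show "\<phi> (g \<otimes>\<^bsub>G\<^esub> g') = \<phi> g \<otimes>\<^bsub>BijGroup X\<^esub> \<phi> g'"
      using Bij by (simp add: BijGroup_def)
  next
    show "\<phi> g \<in> carrier (BijGroup X)" for g using Bij by (simp add: BijGroup_def)
  qed (fact is_group group_BijGroup)+
  then have "group_action G X \<phi>" by (rule group_action.intro)
  moreover have "card (invariants X \<phi> (\<sigma> [^]\<^bsub>G\<^esub> k)) = (\<Sum>D | D dvd n \<and> int D dvd k. orbs D * D)" for k :: int
  proof -
    have inv: "invariants X \<phi> (\<sigma> [^]\<^bsub>G\<^esub> k) = {x \<in> X. int (fst (h x)) dvd k}"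
      by (auto simp: invariants_def \<phi> act_fix)
    have bij_k: "bij_betw h {x \<in> X. int (fst (h x)) dvd k} {y \<in> Y. int (fst y) dvd k}"
      using h by (auto simp: bij_betw_def inj_on_def)
    have Y_k: "{y \<in> Y. int (fst y) dvd k} = (SIGMA D:{D. D dvd n \<and> int D dvd k}. {..<orbs D} \<times> {..<D})"
      by (auto simp: Y_def)
    have "card (invariants X \<phi> (\<sigma> [^]\<^bsub>G\<^esub> k)) = card (SIGMA D:{D. D dvd n \<and> int D dvd k}. {..<orbs D} \<times> {..<D})"
      using bij_k unfolding inv Y_k by (rule bij_betw_same_card)
    also have "\<dots> = (\<Sum>D | D dvd n \<and> int D dvd k. orbs D * D)"
      using fin by (subst card_SigmaI) (auto simp: card_cartesian_product)
    finally show ?thesis .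
  qed
  ultimately show ?thesis by blast
qed

text \<open>
  Here \<open>s\<close> is the statistic with generating function \<open>f\<close>, and \<open>T D\<close> is the intended number of points in
  orbits of size \<open>D\<close>, so that there are \<open>T D div D\<close> such orbits.
\<close>

lemma cyclic_sieving_criterion:
  fixes G :: "('g, 'z) monoid_scheme" and X :: "'a set" and s :: "'a \<Rightarrow> nat" and T :: "nat \<Rightarrow> int"
  assumes G: "cyclic_of_order n G \<sigma>" and \<omega>: "primitive_root_of_unity n \<omega>" and X: "finite X"
    and f: "\<And>z :: complex. poly (map_poly of_nat f) z = (\<Sum>x\<in>X. z ^ s x)"
    and vals: "\<And>k. (\<Sum>x\<in>X. \<omega> ^ (k * s x)) = of_int (\<Sum>E | E dvd gcd k n. T E)"
    and T: "\<And>D. D dvd n \<Longrightarrow> 0 \<le> T D"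
  shows "\<exists>\<phi>. cyclic_sieving n \<omega> G \<sigma> \<phi> X f"
proof -
  have n: "n > 0" using \<omega> by (simp add: primitive_root_of_unity_def)
  define orbs where "orbs D = nat (T D) div D" for D
  have orbs: "int (orbs D * D) = T D" if "D dvd n" for D

  proof -
    have T_nat: "T D = int (nat (T D))" using T[OF that] by simp
    then have "D dvd nat (T D)" using dvd_orbit_size_total[OF \<omega> X vals that] by (metis of_nat_dvd_iff)
    then show ?thesis using T_nat by (simp add: orbs_def)
  qed
  have sum: "int (\<Sum>D\<in>A. orbs D * D) = (\<Sum>D\<in>A. T D)" if "A \<subseteq> {D. D dvd n}" for A
    unfolding of_nat_sum using that orbs by (intro sum.cong) auto
  have "of_nat (card X) = (of_int (\<Sum>E | E dvd n. T E) :: complex)"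
    using vals[of 0] by simp
  then have "int (card X) = (\<Sum>E | E dvd n. T E)" by (metis of_int_eq_iff of_int_of_nat_eq)
  then have "int (card X) = int (\<Sum>D | D dvd n. orbs D * D)" using sum[OF order_refl] by (simp only:)
  then have "card X = (\<Sum>D | D dvd n. orbs D * D)" by (simp only: of_nat_eq_iff)
  then obtain \<phi> where \<phi>: "group_action G X \<phi>"
    and inv: "\<And>k::int. card (invariants X \<phi> (\<sigma> [^]\<^bsub>G\<^esub> k)) = (\<Sum>D | D dvd n \<and> int D dvd k. orbs D * D)"
    using cyclic_action_with_orbit_counts[OF G n X] by blast
  have "poly (map_poly of_nat f) (\<omega> powi k) = of_nat (card (invariants X \<phi> (\<sigma> [^]\<^bsub>G\<^esub> k)))" for k :: int
  proof -
    define k' where "k' = nat (k mod int n)"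
    have k': "int k' = k mod int n" using n by (simp add: k'_def)
    have "\<omega> \<noteq> 0" "\<omega> ^ n = 1" using \<omega> by (auto simp: primitive_root_of_unity_def power_0_left)
    have "\<omega> powi k = \<omega> powi (int n * (k div int n) + int k')" by (simp add: k')
    also have "\<dots> = \<omega> ^ k'"
      using \<open>\<omega> \<noteq> 0\<close> \<open>\<omega> ^ n = 1\<close> by (simp add: power_int_add power_int_mult)
    finally have "poly (map_poly of_nat f) (\<omega> powi k) = of_int (\<Sum>E | E dvd gcd k' n. T E)"
      using f vals[of k'] by (simp add: power_mult)
    also have "{E. E dvd gcd k' n} = {D. D dvd n \<and> int D dvd k}"
    proof -
      have "E dvd k' \<longleftrightarrow> int E dvd k" if "E dvd n" for E
        using that k' by (metis dvd_mod_iff of_nat_dvd_iff)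
      then show ?thesis by auto
    qed
    also have "(\<Sum>D | D dvd n \<and> int D dvd k. T D) = int (\<Sum>D | D dvd n \<and> int D dvd k. orbs D * D)"
      by (rule sum[symmetric]) auto
    finally show ?thesis by (simp add: inv)
  qed
  then show ?thesis using G \<omega> X \<phi> unfolding cyclic_sieving_def by blast
qed

section \<open>Cyclic sieving for rectangular tableaux\<close>

lemma poly_principal_schur:
  fixes z :: complex
  shows "poly (map_poly of_nat (principal_schur lam m)) z =
    (\<Sum>T\<in>SSYT lam m. z ^ (\<Sum>c\<in>young_diagram lam. T c))"
proof -
  have add: "map_poly of_nat (p + q) = (map_poly of_nat p + map_poly of_nat q :: complex poly)" for p q
    by (rule poly_eqI) (simp add: coeff_map_poly)
  have "poly (map_poly of_nat (\<Sum>T\<in>A. Polynomial.monom 1 (s T))) z = (\<Sum>T\<in>A. z ^ s T)"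
    if "finite A" for A and s :: "(nat \<times> nat \<Rightarrow> nat) \<Rightarrow> nat"
    using that by (induction A) (simp_all add: add map_poly_monom poly_monom)
  moreover have "principal_schur lam m = (\<Sum>T\<in>SSYT lam m. Polynomial.monom 1 (\<Sum>c\<in>young_diagram lam. T c))"
    unfolding principal_schur_def schur_as_weight_sum
    by (simp only: power_sum[symmetric]) (simp add: monom_power)
  ultimately show ?thesis by simp
qed

lemma schur_principal_specialisation:
  fixes z :: complex
  shows "schur lam m (\<lambda>i. z ^ i) = (\<Sum>T\<in>SSYT lam m. z ^ (\<Sum>c\<in>young_diagram lam. T c))"
  unfolding schur_as_weight_sum by (simp add: power_sum)

theorem theorem3p7:
  fixes n m a b :: nat
    and G :: "('g, 'z) monoid_scheme" and \<sigma> :: 'g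
    and \<omega> :: complex
  assumes "b < m" and "n dvd b" and "n dvd m"
    and "cyclic_of_order n G \<sigma>"
    and "primitive_root_of_unity n \<omega>"
  shows "\<exists>\<phi>. cyclic_sieving n \<omega> G \<sigma> \<phi>
           (SSYT (scale_partition n (replicate b a)) m)
           (principal_schur (scale_partition n (replicate b a)) m)"
proof -
  note \<omega> = assms(5)
  have n: "n > 0" using \<omega> by (simp add: primitive_root_of_unity_def)
  obtain B M where b: "b = n * B" and m: "m = n * M" using assms(2,3) by (auto elim!: dvdE)
  then have BM: "B < M" using assms(1) by simp
  define K where "K j = card (SSYT (shape (B * j) (\<lambda>_. a * j)) (M * j))" for j
  define F where "F j = K j ^ (n div j)" for j
  let ?lam = "scale_partition n (replicate b a)"
  have lam: "?lam = shape b (\<lambda>_. n * a)" by (simp add: scale_partition_def map_replicate_const)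
  define s where "s T = (\<Sum>c\<in>young_diagram ?lam. T c)" for T :: "nat \<times> nat \<Rightarrow> nat"
  have root_values: "(\<Sum>T\<in>SSYT ?lam m. \<omega> ^ (k * s T)) = of_nat (F (gcd k n))" for k
  proof -
    let ?j = "gcd k n"
    define d where "d = n div ?j"
    have nd: "n = d * ?j" and "?j > 0" using n by (simp_all add: d_def)
    have "(\<Sum>T\<in>SSYT ?lam m. \<omega> ^ (k * s T)) = schur ?lam m (\<lambda>i. (\<omega> ^ k) ^ i)"
      unfolding schur_principal_specialisation s_def by (simp add: power_mult)
    also have "\<dots> = schur (shape (d * (B * ?j)) (\<lambda>_. d * (a * ?j))) (d * (M * ?j)) (\<lambda>i. (\<omega> ^ k) ^ i)"
    proof -
      have "b = d * (B * ?j)" "n * a = d * (a * ?j)" "m = d * (M * ?j)"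
        using b m nd by (metis mult.assoc mult.commute)+
      then show ?thesis unfolding lam by (simp only:)
    qed
    also have "\<dots> = of_nat (K ?j) ^ d"
      unfolding K_def
      by (rule schur_rectangle_at_roots) (use primitive_root_power[OF \<omega>, of k] in \<open>simp add: d_def\<close>)
    finally show ?thesis by (simp add: F_def d_def)
  qed
  have "\<exists>T. (\<forall>j. j dvd n \<longrightarrow> (\<Sum>E | E dvd j. T E) = int (F j)) \<and> (\<forall>D. D dvd n \<longrightarrow> 0 \<le> T D)"
  proof (cases "a = 0 \<or> B = 0")
    case True
    \<comment> \<open>The shape has no boxes, so there is one tableau and the action is trivial.\<close>
    then have "K j = 1" for j unfolding K_def by (intro card_empty_shape_SSYT) auto
    then have "F j = 1" for j by (simp add: F_def)
    moreover have "(\<Sum>E | E dvd j. if E = 1 then 1 else 0 :: int) = 1" if "j dvd n" for j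
    proof -
      have "finite {E. E dvd j}" using that n by (simp add: dvd_pos_nat)
      then show ?thesis by simp
    qed
    ultimately show ?thesis by (intro exI[of _ "\<lambda>E. if E = 1 then 1 else 0"]) simp
  next
    case False
    have K: "K j = card (box_partitions (B * j) (a * j) ((M - B) * j))" for j
      using BM by (simp add: K_def card_rectangular_SSYT diff_mult_distrib)
    have growth: "F E ^ (k + 1) \<le> F (E * k) ^ 2" if "E * k dvd n" for E k
    proof -
      obtain q where q: "n = E * k * q" using \<open>E * k dvd n\<close> by blast
      then have "E > 0" "k > 0" using n by auto
      then have div: "n div E = k * q" "n div (E * k) = q" using q by simp_all
      have "F E ^ (k + 1) = (K E ^ (k * (k + 1))) ^ q"
        by (simp only: F_def div mult_ac flip: power_mult)
      also have "\<dots> \<le> (K (E * k) ^ 2) ^ q"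
        using box_partitions_stack[of "B * E" "a * E" "(M - B) * E" k]
        by (intro power_mono) (simp_all only: K mult_ac zero_le)
      also have "\<dots> = F (E * k) ^ 2" by (simp only: F_def div mult.commute flip: power_mult)
      finally show ?thesis .
    qed
    have "2 \<le> K 1" using two_le_card_box_partitions[of B a "M - B"] False BM by (simp add: K)
    then have F1: "2 ^ n \<le> F 1" by (simp add: F_def power_mono)
    let ?T = "divisor_inverse (\<lambda>j. int (F j))"
    have T: "(\<Sum>E | E dvd j. ?T E) = int (F j)" if "j dvd n" for j
      using that n by (simp add: sum_divisor_inverse dvd_pos_nat)
    have "0 \<le> ?T D" if "D dvd n" for D
    proof (rule nonneg_if_dominates_divisors[of n ?T "\<lambda>j. int (F j)", OF T _ n that])
      fix j assume j: "j dvd n"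
      have "(\<Sum>E\<in>{E. E dvd j \<and> E < j}. F E) \<le> F j"
        by (rule growth_dominates_divisors[where F = F, OF n F1]) (erule growth, rule j)
      then show "(\<Sum>E\<in>{E. E dvd j \<and> E < j}. int (F E)) \<le> int (F j)"
        by (simp only: of_nat_sum[symmetric] of_nat_le_iff)
    qed
    then show ?thesis using T by (intro exI[of _ ?T]) simp
  qed
  then obtain T where T: "\<And>j. j dvd n \<Longrightarrow> (\<Sum>E | E dvd j. T E) = int (F j)"
    and T_nonneg: "\<And>D. D dvd n \<Longrightarrow> 0 \<le> T D" by blast
  show ?thesis
  proof (rule cyclic_sieving_criterion[OF assms(4) \<omega> _ _ _ T_nonneg])
    show "poly (map_poly of_nat (principal_schur ?lam m)) z = (\<Sum>x\<in>SSYT ?lam m. z ^ s x)" for z :: complex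
      by (simp add: poly_principal_schur s_def)
    show "(\<Sum>x\<in>SSYT ?lam m. \<omega> ^ (k * s x)) = of_int (\<Sum>E | E dvd gcd k n. T E)" for k
      using T[of "gcd k n"] by (simp only: root_values) simp
  qed simp_all
qed

end
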